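(* Let $\Omega\subset\mathbb{R}^d$ be a bounded domain and let $J$ satisfy all of the following: (a) $J:L^2(\Omega)\to\mathbb{R}$ is bounded from below; (b) $J:L^1(\Omega)\to\mathbb{R}$ is Fréchet differentiable; (c) $\nabla J:L^1(\Omega)\to L^2(\Omega)$ is Lipschitz continuous; (d) $\nabla J:L^2(\Omega)\to L^2(\Omega)$ is weak-norm continuous (completely continuous). Let $(U^n)_n\subset\mathcal{B}$ be the sequence of sets produced by the binary trust-region steepest descent (BTR) algorithm described in the context. Then all weak-$^*$ accumulation points of $(\chi_{U^n})_n$ in $L^\infty(\Omega)$ are feasible and stationary for (R).
   Context: $\Omega\subset\mathbb{R}^d$ is a bounded domain, $\lambda$ is Lebesgue measure, $\mathcal{B}$ the Borel $\sigma$-algebra on $\Omega$, $A^c=\Omega\setminus A$, $\triangle$ the symmetric difference, $\chi_A$ the $\{0,1\}$-valued characteristic function of $A$. The derivative of $J:L^1(\Omega)\to\mathbb{R}$ at $x$ is represented by $\nabla J(x)\in L^\infty(\Omega)\subset L^2(\Omega)$; on $L^2(\Omega)\subset L^1(\Omega)$, $J$ is the restriction. Weak-norm continuous means: $x^n\rightharpoonup x$ in $L^2(\Omega)$ implies $\nabla J(x^n)\to\nabla J(x)$ in $L^2(\Omega)$. Relaxed problem (R): minimize $J(x)$ over $x\in L^2(\Omega)$ with $x(s)\in[0,1]$ for a.a. $s\in\Omega$; such $x$ are called feasible for (R). Criticality measure: for $x\in L^2(\Omega)$, $C(x):=\max\{\int_\Omega\nabla J(x)(x-f)\,\mathrm{d}s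 : f \text{ feasible for (R)}\}=\int_\Omega\nabla J(x)x\,\mathrm{d}s+\int_\Omega\max\{-\nabla J(x),0\}\,\mathrm{d}s$. A feasible $x$ for (R) is called stationary if $C(x)=0$. BTR algorithm. Inputs: $J$, $\nabla J$, $\Delta_{\max}\in(0,\lambda(\Omega))$, $0<\sigma_1<\sigma_2\le1$, $\omega\in(0,1)$, $U^0\in\mathcal{B}$, $\Delta^0\in(0,\Delta_{\max})$. For $n=0,1,2,\dots$: - Set $g^n:=\nabla J(\chi_{U^n})(\chi_{(U^n)^c}-\chi_{U^n})$ (pointwise product). - Set $D^n:=\mathtt{FindStep}(g^n,\Delta^n,\delta^n)$ with $\delta^n:=\min\{\omega,\ \tfrac12\|\min\{g^n,0\}\|_{L^1}/\lambda(\Omega),\ \Delta^n\}$. Here $\mathtt{FindStep}(g,\Delta,\delta)$ is any procedure returning a set $D\in\mathcal{B}$ with $D\subset g^{-1}((-\infty,0])$, $\lambda(D)\le\Delta$ and $\int_D g\,\mathrm{d}s\le\min\{\int_{D'}g\,\mathrm{d}s : D'\in\mathcal{B},\ D'\subset g^{-1}((-\infty,0]),\ \lambda(D')\le\Delta\}+\delta\Delta$. - Let $p^n:=(\nabla J(\chi_{U^n}),\chi_{D^n\setminus U^n}-\chi_{U^n\cap D^n})_{L^2}$. If $J(\chi_{U^n\triangle D^n})-J(\chi_{U^n})\le\sigma_1p^n$ (step accepted), set $U^{n+1}:=U^n\triangle D^n$, and set $\Delta^{n+1}:=\min\{2\Delta^n,\Delta_{\max}\}$ if moreover $J(\chi_{U^n\triangle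 D^n})-J(\chi_{U^n})\le\sigma_2p^n$, and $\Delta^{n+1}:=\Delta^n$ otherwise. If the step is not accepted, set $U^{n+1}:=U^n$, $\Delta^{n+1}:=\tfrac12\Delta^n$. *)

theory Defs
  imports "HOL-Analysis.Analysis"
begin

(* Elements of the Lebesgue spaces are represented by measurable functions instead of classes
   of functions; functionals on such a space are required to respect equality almost
   everywhere (AE_invariant).  The definitions are stated for a measure M; the theorem uses
   M = restrict_space lborel Omega, i.e. Lebesgue measure on the Borel subsets of Omega. *)

definition space_L1 :: "'a measure \<Rightarrow> ('a \<Rightarrow> real) set" where
  "space_L1 M = {f. integrable M f}"

definition space_L2 :: "'a measure \<Rightarrow> ('a \<Rightarrow> real) set" where
  "space_L2 M = {f \<in> borel_measurable M. integrable M (\<lambda>s. (f s)\<^sup>2)}"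

definition space_Linf :: "'a measure \<Rightarrow> ('a \<Rightarrow> real) set" where
  "space_Linf M = {f \<in> borel_measurable M. \<exists>c. AE s in M. \<bar>f s\<bar> \<le> c}"

definition norm_L1 :: "'a measure \<Rightarrow> ('a \<Rightarrow> real) \<Rightarrow> real" where
  "norm_L1 M f = (\<integral>s. \<bar>f s\<bar> \<partial>M)"

definition norm_L2 :: "'a measure \<Rightarrow> ('a \<Rightarrow> real) \<Rightarrow> real" where
  "norm_L2 M f = sqrt (\<integral>s. (f s)\<^sup>2 \<partial>M)"

definition inner_L2 :: "'a measure \<Rightarrow> ('a \<Rightarrow> real) \<Rightarrow> ('a \<Rightarrow> real) \<Rightarrow> real" where
  "inner_L2 M f g = (\<integral>s. f s * g s \<partial>M)"

definition AE_invariant :: "'a measure \<Rightarrow> (('a \<Rightarrow> real) \<Rightarrow> real) \<Rightarrow> bool" where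
  "AE_invariant M J \<longleftrightarrow>
    (\<forall>x \<in> space_L1 M. \<forall>y \<in> space_L1 M. (AE s in M. x s = y s) \<longrightarrow> J x = J y)"

definition bounded_linear_on_L1 :: "'a measure \<Rightarrow> (('a \<Rightarrow> real) \<Rightarrow> real) \<Rightarrow> bool" where
  "bounded_linear_on_L1 M T \<longleftrightarrow>
    (\<forall>h \<in> space_L1 M. \<forall>k \<in> space_L1 M. T (\<lambda>s. h s + k s) = T h + T k) \<and>
    (\<forall>h \<in> space_L1 M. \<forall>c. T (\<lambda>s. c * h s) = c * T h) \<and>
    (\<exists>K. \<forall>h \<in> space_L1 M. \<bar>T h\<bar> \<le> K * norm_L1 M h)"

definition has_L1_derivative ::
  "'a measure \<Rightarrow> (('a \<Rightarrow> real) \<Rightarrow> real) \<Rightarrow> (('a \<Rightarrow> real) \<Rightarrow> real) \<Rightarrow> ('a \<Rightarrow> real) \<Rightarrow> bool" where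
  "has_L1_derivative M J T x \<longleftrightarrow>
    bounded_linear_on_L1 M T \<and>
    (\<forall>e>0. \<exists>d>0. \<forall>h \<in> space_L1 M. norm_L1 M h < d \<longrightarrow>
       \<bar>J (\<lambda>s. x s + h s) - J x - T h\<bar> \<le> e * norm_L1 M h)"

definition L1_differentiable :: "'a measure \<Rightarrow> (('a \<Rightarrow> real) \<Rightarrow> real) \<Rightarrow> bool" where
  "L1_differentiable M J \<longleftrightarrow> (\<forall>x \<in> space_L1 M. \<exists>T. has_L1_derivative M J T x)"

definition is_gradient ::
  "'a measure \<Rightarrow> (('a \<Rightarrow> real) \<Rightarrow> real) \<Rightarrow> (('a \<Rightarrow> real) \<Rightarrow> 'a \<Rightarrow> real) \<Rightarrow> bool" where
  "is_gradient M J G \<longleftrightarrow>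
    (\<forall>x \<in> space_L1 M. G x \<in> space_Linf M \<and>
       has_L1_derivative M J (\<lambda>h. \<integral>s. G x s * h s \<partial>M) x)"

definition lipschitz_L1_L2 :: "'a measure \<Rightarrow> (('a \<Rightarrow> real) \<Rightarrow> 'a \<Rightarrow> real) \<Rightarrow> bool" where
  "lipschitz_L1_L2 M G \<longleftrightarrow>
    (\<forall>x \<in> space_L1 M. G x \<in> space_L2 M) \<and>
    (\<exists>L. \<forall>x \<in> space_L1 M. \<forall>y \<in> space_L1 M.
       norm_L2 M (\<lambda>s. G x s - G y s) \<le> L * norm_L1 M (\<lambda>s. x s - y s))"

definition weakly_converges_L2 ::
  "'a measure \<Rightarrow> (nat \<Rightarrow> 'a \<Rightarrow> real) \<Rightarrow> ('a \<Rightarrow> real) \<Rightarrow> bool" where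
  "weakly_converges_L2 M xs x \<longleftrightarrow>
    (\<forall>\<phi> \<in> space_L2 M. (\<lambda>n. inner_L2 M (xs n) \<phi>) \<longlonglongrightarrow> inner_L2 M x \<phi>)"

definition weak_norm_continuous_L2 :: "'a measure \<Rightarrow> (('a \<Rightarrow> real) \<Rightarrow> 'a \<Rightarrow> real) \<Rightarrow> bool" where
  "weak_norm_continuous_L2 M G \<longleftrightarrow>
    (\<forall>xs x. (\<forall>n. xs n \<in> space_L2 M) \<and> x \<in> space_L2 M \<and> weakly_converges_L2 M xs x
       \<longrightarrow> (\<lambda>n. norm_L2 M (\<lambda>s. G (xs n) s - G x s)) \<longlonglongrightarrow> 0)"

(* The weak-* topology of Linf as the dual of L1: the coarsest topology on Linf making
   f |-> integral f phi continuous for every phi in L1.  Its points are representatives, so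
   it does not separate functions that agree almost everywhere. *)
definition weak_star_topology :: "'a measure \<Rightarrow> ('a \<Rightarrow> real) topology" where
  "weak_star_topology M = topology_generated_by
    {{f \<in> space_Linf M. (\<integral>s. f s * \<phi> s \<partial>M) \<in> V} | \<phi> V. \<phi> \<in> space_L1 M \<and> open V}"

(* Topological accumulation (cluster) points of a sequence; this includes the limits of all
   convergent subsequences. *)
definition accumulation_point :: "'b topology \<Rightarrow> (nat \<Rightarrow> 'b) \<Rightarrow> 'b \<Rightarrow> bool" where
  "accumulation_point T xs x \<longleftrightarrow>
    x \<in> topspace T \<and> (\<forall>V. openin T V \<and> x \<in> V \<longrightarrow> (\<exists>\<^sub>F n in sequentially. xs n \<in> V))"

definition feasible_R :: "'a measure \<Rightarrow> ('a \<Rightarrow> real) set" where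
  "feasible_R M = {x \<in> space_L2 M. AE s in M. 0 \<le> x s \<and> x s \<le> 1}"

(* For G x in Linf and M finite the supremum is over a bounded set and is attained, by the
   indicator function of {s. G x s < 0}. *)
definition criticality ::
  "'a measure \<Rightarrow> (('a \<Rightarrow> real) \<Rightarrow> 'a \<Rightarrow> real) \<Rightarrow> ('a \<Rightarrow> real) \<Rightarrow> real" where
  "criticality M G x = (SUP f \<in> feasible_R M. \<integral>s. G x s * (x s - f s) \<partial>M)"

definition stationary_R ::
  "'a measure \<Rightarrow> (('a \<Rightarrow> real) \<Rightarrow> 'a \<Rightarrow> real) \<Rightarrow> ('a \<Rightarrow> real) \<Rightarrow> bool" where
  "stationary_R M G x \<longleftrightarrow> x \<in> feasible_R M \<and> criticality M G x = 0"

definition step_candidates :: "'a measure \<Rightarrow> ('a \<Rightarrow> real) \<Rightarrow> real \<Rightarrow> 'a set set" where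
  "step_candidates M g \<Delta> = {D \<in> sets M. D \<subseteq> g -` {..0} \<and> measure M D \<le> \<Delta>}"

(* Admissible results of FindStep (g, Delta, delta).  The infimum is the minimum of the
   informal specification: it is attained for integrable g on a finite atomless M. *)
definition find_step :: "'a measure \<Rightarrow> ('a \<Rightarrow> real) \<Rightarrow> real \<Rightarrow> real \<Rightarrow> 'a set \<Rightarrow> bool" where
  "find_step M g \<Delta> \<delta> D \<longleftrightarrow>
    D \<in> step_candidates M g \<Delta> \<and>
    (\<integral>s. g s * indicator D s \<partial>M)
      \<le> (INF D' \<in> step_candidates M g \<Delta>. \<integral>s. g s * indicator D' s \<partial>M) + \<delta> * \<Delta>"

definition descent_density ::
  "'a measure \<Rightarrow> (('a \<Rightarrow> real) \<Rightarrow> 'a \<Rightarrow> real) \<Rightarrow> 'a set \<Rightarrow> 'a \<Rightarrow> real" where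
  "descent_density M G U =
    (\<lambda>s. G (indicator U) s * (indicator (space M - U) s - indicator U s))"

definition step_tolerance :: "'a measure \<Rightarrow> real \<Rightarrow> ('a \<Rightarrow> real) \<Rightarrow> real \<Rightarrow> real" where
  "step_tolerance M \<omega> g \<Delta> =
    Min {\<omega>, 1 / 2 * norm_L1 M (\<lambda>s. min (g s) 0) / measure M (space M), \<Delta>}"

definition predicted_change ::
  "'a measure \<Rightarrow> (('a \<Rightarrow> real) \<Rightarrow> 'a \<Rightarrow> real) \<Rightarrow> 'a set \<Rightarrow> 'a set \<Rightarrow> real" where
  "predicted_change M G U D =
    inner_L2 M (G (indicator U)) (\<lambda>s. indicator (D - U) s - indicator (U \<inter> D) s)"

definition actual_change :: "(('a \<Rightarrow> real) \<Rightarrow> real) \<Rightarrow> 'a set \<Rightarrow> 'a set \<Rightarrow> real" where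
  "actual_change J U D = J (indicator (sym_diff U D)) - J (indicator U)"

(* (U, Delta, D) is a run of the algorithm.  FindStep is nondeterministic: any D n that
   satisfies its specification is allowed in iteration n. *)
definition BTR_run ::
  "'a measure \<Rightarrow> (('a \<Rightarrow> real) \<Rightarrow> real) \<Rightarrow> (('a \<Rightarrow> real) \<Rightarrow> 'a \<Rightarrow> real)
    \<Rightarrow> real \<Rightarrow> real \<Rightarrow> real \<Rightarrow> real
    \<Rightarrow> (nat \<Rightarrow> 'a set) \<Rightarrow> (nat \<Rightarrow> real) \<Rightarrow> (nat \<Rightarrow> 'a set) \<Rightarrow> bool" where
  "BTR_run M J G \<Delta>max \<sigma>1 \<sigma>2 \<omega> U \<Delta> D \<longleftrightarrow>
    0 < \<Delta>max \<and> \<Delta>max < measure M (space M) \<and>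
    0 < \<sigma>1 \<and> \<sigma>1 < \<sigma>2 \<and> \<sigma>2 \<le> 1 \<and> 0 < \<omega> \<and> \<omega> < 1 \<and>
    U 0 \<in> sets M \<and> 0 < \<Delta> 0 \<and> \<Delta> 0 < \<Delta>max \<and>
    (\<forall>n. let g = descent_density M G (U n);
             p = predicted_change M G (U n) (D n);
             a = actual_change J (U n) (D n)
         in find_step M g (\<Delta> n) (step_tolerance M \<omega> g (\<Delta> n)) (D n) \<and>
            (if a \<le> \<sigma>1 * p
             then U (Suc n) = sym_diff (U n) (D n) \<and>
                  \<Delta> (Suc n) = (if a \<le> \<sigma>2 * p then min (2 * \<Delta> n) \<Delta>max else \<Delta> n)
             else U (Suc n) = U n \<and> \<Delta> (Suc n) = \<Delta> n / 2))"

end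

(* Let C(U) denote the L1 norm of min(g, 0) for the descent density g of U; it equals the
   criticality measure at chi_U.  Among the sets of measure Delta, a superlevel set of the negative
   part of g carries at least its average share, so an admissible step predicts a decrease of at
   least Delta C(U) / (2 lambda(Omega)).  By the mean value theorem and the Lipschitz gradient, the
   actual change differs from the prediction by at most L Delta^(3/2).  Steps with a radius small
   relative to C(U)^2 are therefore accepted, and since J is bounded below, C(U^n) comes arbitrarily
   close to 0.  While C(U^n) stays above some eps > 0, the total measure moved is bounded by a
   multiple of the decrease of J, and C is Hoelder continuous with exponent 1/2 in the measure of
   the symmetric difference; hence C(U^n) cannot return to 2 eps infinitely often, and C(U^n) -> 0.

   The Borel sets have a countable generator, so a weak-* accumulation point x is the weak limit in
   L2 of a subsequence.  Along it the gradients converge in norm, and the integral of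
   grad J(x) (x - f) is, for each feasible f, the limit of quantities bounded by C(U^n) -> 0. *)
theory Submission
  imports Defs
begin

section \<open>Trust-region sequences\<close>

text \<open>Here \<open>s n\<close> is the measure that iteration \<open>n\<close> may move: the radius if the step is accepted,
  0 otherwise.\<close>

lemma trust_region_criticality_tendsto_0:
  fixes J C \<Delta> p a s :: "nat \<Rightarrow> real"
  assumes pos: "0 < \<kappa>" "0 < L" "0 < K" "0 < \<sigma>" "\<sigma> < 1" "0 < \<Delta> 0"
    and C_nonneg: "\<And>n. 0 \<le> C n"
    and model: "\<And>n. p n \<le> - (\<kappa> * \<Delta> n * C n)"
    and err: "\<And>n. a n - p n \<le> L * (\<Delta> n * sqrt (\<Delta> n))"
    and accept: "\<And>n. a n \<le> \<sigma> * p n \<Longrightarrow> J (Suc n) = J n + a n \<and> \<Delta> n \<le> \<Delta> (Suc n) \<and> s n = \<Delta> n"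
    and reject: "\<And>n. \<not> a n \<le> \<sigma> * p n \<Longrightarrow> J (Suc n) = J n \<and> \<Delta> (Suc n) = \<Delta> n / 2 \<and> s n = 0"
    and lower: "\<And>n. c \<le> J n"
    and modulus: "\<And>n m. n \<le> m \<Longrightarrow> \<bar>C n - C m\<bar> \<le> K * sqrt (\<Sum>i=n..<m. s i)"
  shows "C \<longlonglongrightarrow> 0"
proof -
  have \<Delta>_pos: "0 < \<Delta> n" for n
  proof (induction n)
    case (Suc n)
    then show ?case
      using accept[of n] reject[of n] by (cases "a n \<le> \<sigma> * p n") auto
  qed (use pos in simp)
  have s_nonneg: "0 \<le> s n" for n
    using accept[of n] reject[of n] \<Delta>_pos[of n] by (cases "a n \<le> \<sigma> * p n") auto
  \<comment> \<open>Each unit of moved measure lowers \<open>J\<close> by at least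
    \<open>\<sigma> * \<kappa> * C n\<close>; for a rejected iteration both sides are 0.\<close>
  have decrease: "\<sigma> * \<kappa> * C n * s n \<le> J n - J (Suc n)" for n
  proof (cases "a n \<le> \<sigma> * p n")
    case True
    have "\<sigma> * p n \<le> \<sigma> * (- (\<kappa> * \<Delta> n * C n))"
      using model[of n] pos by (intro mult_left_mono) auto
    with True accept[OF True] show ?thesis by (simp add: algebra_simps)
  next
    case False
    with reject[of n] show ?thesis by auto
  qed
  have "J (Suc n) \<le> J n" for n
  proof -
    have "0 \<le> \<sigma> * \<kappa> * C n * s n" using pos C_nonneg s_nonneg by simp
    with decrease[of n] show ?thesis by linarith
  qed
  then have dec: "decseq J" by (simp add: decseq_Suc_iff)
  then obtain l where J_lim: "J \<longlonglongrightarrow> l"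
    using decseq_convergent[OF dec, of c] lower by metis
  have sum_le: "\<sigma> * \<kappa> * e * (\<Sum>i=n..<m. s i) \<le> J n - J m"
    if "n \<le> m" "\<And>i. n \<le> i \<Longrightarrow> i < m \<Longrightarrow> e \<le> C i" for n m e
    using that
  proof (induction m rule: dec_induct)
    case (step m)
    have "\<sigma> * \<kappa> * e * s m \<le> \<sigma> * \<kappa> * C m * s m"
      using step pos s_nonneg by (intro mult_right_mono mult_left_mono) auto
    with step decrease[of m] show ?case by (simp add: algebra_simps)
  qed simp
  \<comment> \<open>If \<open>C\<close> stayed above \<open>e\<close>, the radii would be bounded
    away from 0. Since the decreases of \<open>J\<close> tend to 0, every late step would then be
    rejected, and endless halving contradicts that bound.\<close>
  have liminf: "\<exists>m\<ge>n. C m < e" if "0 < e" for n e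
  proof (rule ccontr)
    assume "\<not> ?thesis"
    then have large: "e \<le> C m" if "n \<le> m" for m using that by (auto simp: not_less)
    \<comment> \<open>At a radius up to \<open>t\<close> the model error
      \<open>L * (\<Delta> m * sqrt (\<Delta> m))\<close> stays within the slack
      \<open>(1 - \<sigma>) * (\<kappa> * \<Delta> m * e)\<close> of the acceptance test, so the
      step is accepted.\<close>
    define t where "t = ((1 - \<sigma>) * \<kappa> * e / L)\<^sup>2"
    have t: "0 < t" unfolding t_def using pos that by simp
    have rejected_large: "t < \<Delta> m" if "n \<le> m" "\<not> a m \<le> \<sigma> * p m" for m
    proof -
      have "(1 - \<sigma>) * (\<kappa> * \<Delta> m * e) \<le> (1 - \<sigma>) * (\<kappa> * \<Delta> m * C m)"
        using large[OF that(1)] pos \<Delta>_pos[of m] by (intro mult_left_mono) auto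
      also have "\<dots> \<le> (1 - \<sigma>) * (- p m)"
        using model[of m] pos by (intro mult_left_mono) auto
      also have "\<dots> < a m - p m" using that(2) by (simp add: algebra_simps)
      also have "\<dots> \<le> L * (\<Delta> m * sqrt (\<Delta> m))" by (rule err)
      finally have "\<Delta> m * ((1 - \<sigma>) * \<kappa> * e) < \<Delta> m * (L * sqrt (\<Delta> m))"
        by (simp add: algebra_simps)
      then have "(1 - \<sigma>) * \<kappa> * e < L * sqrt (\<Delta> m)" using \<Delta>_pos[of m] by simp
      then have "(1 - \<sigma>) * \<kappa> * e / L < sqrt (\<Delta> m)" using pos by (simp add: field_simps)
      then have "t < (sqrt (\<Delta> m))\<^sup>2"
        unfolding t_def using pos \<open>0 < e\<close> by (intro power_strict_mono) auto
      with \<Delta>_pos[of m] show ?thesis by simp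
    qed
    \<comment> \<open>A rejected radius exceeds \<open>t\<close>, so its half still exceeds
      \<open>t / 2\<close>; an accepted step never shrinks the radius.\<close>
    define r where "r = min (\<Delta> n) (t / 2)"
    have r: "0 < r" unfolding r_def using t \<Delta>_pos by simp
    have radius: "r \<le> \<Delta> m" if "n \<le> m" for m
      using that
    proof (induction m rule: dec_induct)
      case (step m)
      then show ?case
        using accept[of m] reject[of m] rejected_large[of m]
        by (cases "a m \<le> \<sigma> * p m") (auto simp: r_def)
    qed (simp add: r_def)
    have "(\<lambda>m. (J m - J (Suc m)) / (\<sigma> * \<kappa> * e)) \<longlonglongrightarrow> (l - l) / (\<sigma> * \<kappa> * e)"
      by (intro tendsto_intros J_lim LIMSEQ_Suc) (use pos \<open>0 < e\<close> in auto)
    then have "\<forall>\<^sub>F m in sequentially. (J m - J (Suc m)) / (\<sigma> * \<kappa> * e) < r"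
      using r by (intro order_tendstoD(2)[where y = "(l - l) / (\<sigma> * \<kappa> * e)"]) auto
    then obtain N where N: "\<And>m. N \<le> m \<Longrightarrow> (J m - J (Suc m)) / (\<sigma> * \<kappa> * e) < r"
      unfolding eventually_sequentially by auto
    \<comment> \<open>An accepted step of radius at least \<open>r\<close> would lower
      \<open>J\<close> by at least \<open>\<sigma> * \<kappa> * e * r\<close>, which is excluded
      from \<open>N\<close> on.\<close>
    have halved: "\<Delta> (Suc m) = \<Delta> m / 2" if "max n N \<le> m" for m
    proof -
      have "\<sigma> * \<kappa> * e * s m \<le> J m - J (Suc m)"
        using sum_le[of m "Suc m" e] large that by auto
      then have "s m \<le> (J m - J (Suc m)) / (\<sigma> * \<kappa> * e)"
        using pos \<open>0 < e\<close> by (simp add: field_simps)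
      also have "\<dots> < r" using N that by simp
      finally have "s m < \<Delta> m" using radius[of m] that by simp
      then show ?thesis using accept[of m] reject[of m] by auto
    qed
    have "\<Delta> (max n N + k) = \<Delta> (max n N) * (1/2) ^ k" for k
      by (induction k) (auto simp: halved)
    moreover have "(\<lambda>k. \<Delta> (max n N) * (1/2) ^ k) \<longlonglongrightarrow> \<Delta> (max n N) * 0"
      by (intro tendsto_intros) simp
    ultimately have "\<forall>\<^sub>F k in sequentially. \<Delta> (max n N + k) < r"
      using r by (intro order_tendstoD(2)[where y = "\<Delta> (max n N) * 0"]) auto
    then obtain k where "\<Delta> (max n N + k) < r" by (auto simp: eventually_sequentially)
    moreover have "r \<le> \<Delta> (max n N + k)" by (rule radius) linarith
    ultimately show False by linarith
  qed
  show ?thesis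
  proof (rule LIMSEQ_I)
    fix e :: real assume e: "0 < e"
    \<comment> \<open>For \<open>C\<close> to fall from \<open>e\<close> below \<open>e/2\<close>,
      \<open>modulus\<close> requires a moved measure of more than
      \<open>(e / (2*K))\<^sup>2\<close>. At criticality at least \<open>e/2\<close> this costs a
      decrease of more than \<open>q\<close>, but \<open>J\<close> is already within
      \<open>q\<close> of its limit.\<close>
    define q where "q = \<sigma> * \<kappa> * (e/2) * (e / (2*K))\<^sup>2"
    have "0 < q" unfolding q_def using e pos by simp
    then have "\<forall>\<^sub>F n in sequentially. J n < l + q"
      using J_lim by (intro order_tendstoD(2)[OF J_lim]) simp
    then obtain N where N: "\<And>n. N \<le> n \<Longrightarrow> J n < l + q"
      unfolding eventually_sequentially by auto
    have "C n < e" if n: "N \<le> n" for n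
    proof (rule ccontr)
      assume big: "\<not> C n < e"
      obtain m0 where "n \<le> m0" "C m0 < e/2" using liminf[of "e/2" n] e by auto
      \<comment> \<open>Taking the first such index keeps \<open>C\<close> at least
        \<open>e/2\<close> on all earlier ones from \<open>n\<close> on, as \<open>sum_le\<close>
        requires.\<close>
      define m where "m = (LEAST m. n \<le> m \<and> C m < e/2)"
      have m: "n \<le> m \<and> C m < e/2"
        unfolding m_def by (rule LeastI[of _ m0]) (use \<open>n \<le> m0\<close> \<open>C m0 < e/2\<close> in auto)
      have "e/2 \<le> C i" if "n \<le> i" "i < m" for i
        using not_less_Least[of i "\<lambda>m. n \<le> m \<and> C m < e/2"] that unfolding m_def by auto
      then have "\<sigma> * \<kappa> * (e/2) * (\<Sum>i=n..<m. s i) \<le> J n - J m"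
        using m by (intro sum_le) auto
      also have "\<dots> < q" using N[OF n] decseq_ge[OF dec J_lim, of m] by simp
      finally have "(\<Sum>i=n..<m. s i) \<le> (e / (2*K))\<^sup>2"
        unfolding q_def using pos e by simp
      then have "sqrt (\<Sum>i=n..<m. s i) \<le> e / (2*K)"
        using pos e by (intro real_le_lsqrt) (auto intro: sum_nonneg s_nonneg)
      then have "K * sqrt (\<Sum>i=n..<m. s i) \<le> e/2" using pos by (simp add: field_simps)
      with modulus[of n m] m big show False by linarith
    qed
    then show "\<exists>N. \<forall>n\<ge>N. norm (C n - 0) < e" using C_nonneg by auto
  qed
qed

section \<open>Sets of prescribed measure\<close>

lemma lborel_intermediate_set:
  fixes A B :: "'a::euclidean_space set"
  assumes [measurable]: "A \<in> sets borel" "B \<in> sets borel"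
    and "A \<subseteq> B" "bounded B" "measure lborel A \<le> v" "v \<le> measure lborel B"
  obtains E where "E \<in> sets borel" "A \<subseteq> E" "E \<subseteq> B" "measure lborel E = v"
proof -
  \<comment> \<open>intermediate value theorem along growing balls, whose volume is continuous in the radius\<close>
  define E where "E t = A \<union> (B \<inter> ball 0 t)" for t :: real
  have [measurable]: "E t \<in> sets borel" for t unfolding E_def by measurable
  have sub: "E t \<subseteq> B" for t unfolding E_def using assms(3) by auto
  have "emeasure lborel B < \<infinity>" using \<open>bounded B\<close> emeasure_bounded_finite by auto
  then have fin: "E t \<in> fmeasurable lborel" for t
    using emeasure_mono[OF sub[of t], of lborel]
    by (intro fmeasurableI) auto
  \<comment> \<open>For \<open>u \<le> t\<close> the set \<open>E t - E u\<close> lies in the shell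
    between the two balls, so \<open>measure lborel (E t)\<close> inherits the modulus of continuity
    of the volume of balls.\<close>
  have incr: "\<bar>measure lborel (E t) - measure lborel (E u)\<bar>
      \<le> \<bar>measure lborel (ball (0::'a) t) - measure lborel (ball (0::'a) u)\<bar>" for t u
  proof -
    have le: "\<bar>measure lborel (E t) - measure lborel (E u)\<bar>
      \<le> \<bar>measure lborel (ball (0::'a) t) - measure lborel (ball (0::'a) u)\<bar>" if "u \<le> t" for t u
    proof -
      have EE: "E u \<subseteq> E t" and CC: "ball (0::'a) u \<subseteq> ball 0 t"
        using that unfolding E_def by auto
      have [simp]: "ball (0::'a) r \<in> fmeasurable lborel" for r
        using emeasure_bounded_finite[of "ball (0::'a) r"] by (intro fmeasurableI) auto
      have "measure lborel (E t) - measure lborel (E u) = measure lborel (E t - E u)"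
        using measurable_measure_Diff[OF fin[of t] _ EE] by simp
      also have "\<dots> \<le> measure lborel (ball (0::'a) t - ball 0 u)"
        by (intro measure_mono_fmeasurable) (auto simp: E_def intro: fmeasurable_Diff)
      also have "\<dots> = measure lborel (ball (0::'a) t) - measure lborel (ball (0::'a) u)"
        using measurable_measure_Diff[OF _ _ CC, of lborel] by simp
      finally show ?thesis
        using measure_mono_fmeasurable[OF EE _ fin[of t]] by simp
    qed
    show ?thesis using le[of t u] le[of u t] by (cases "u \<le> t") auto
  qed
  obtain R where R: "0 < R" "B \<subseteq> ball 0 R"
    using bounded_subset_ballD[OF \<open>bounded B\<close>] by blast
  have content_ball_0: "measure lborel (ball (0::'a) t) = unit_ball_vol (DIM('a)) * t ^ DIM('a)"
    if "0 \<le> t" for t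
    using that by (rule content_ball)
  have "continuous_on {0..R} (\<lambda>t. unit_ball_vol (DIM('a)) * t ^ DIM('a))"
    by (intro continuous_intros)
  then have "continuous_on {0..R} (\<lambda>t. measure lborel (ball (0::'a) t))"
    by (rule continuous_on_eq) (auto simp: content_ball_0)
  then have "continuous_on {0..R} (\<lambda>t. measure lborel (E t))"
    unfolding continuous_on_iff dist_real_def using incr by (meson le_less_trans)
  moreover have "E 0 = A" "E R = B"
    using R assms(3) unfolding E_def by auto
  ultimately obtain t where "measure lborel (E t) = v"
    using IVT'[of "\<lambda>t. measure lborel (E t)" 0 v R] assms R by auto
  then show ?thesis using that[of "E t"] sub[of t] by (auto simp: E_def)
qed

text \<open>Bathtub principle: if \<open>f\<close> is at least \<open>\<tau>\<close> on
  \<open>D\<close> and at most \<open>\<tau>\<close> off \<open>D\<close>, its mean over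
  \<open>D\<close> is no smaller than its mean over the whole space. The hypothesis
  \<open>intermediate\<close> replaces non-atomicity; it supplies the part of the level set
  \<open>{f = \<tau>}\<close> that fills \<open>D\<close> up to measure
  \<open>\<Delta>\<close>.\<close>

lemma (in finite_measure) ex_set_integral_ge_average:
  fixes f :: "'a \<Rightarrow> real"
  assumes f: "integrable M f" "\<And>s. s \<in> space M \<Longrightarrow> 0 \<le> f s"
    and \<Delta>: "0 < \<Delta>" "\<Delta> < measure M (space M)"
    and intermediate: "\<And>A B. A \<in> sets M \<Longrightarrow> B \<in> sets M \<Longrightarrow> A \<subseteq> B \<Longrightarrow> measure M A \<le> \<Delta>
      \<Longrightarrow> \<Delta> \<le> measure M B \<Longrightarrow> \<exists>E\<in>sets M. A \<subseteq> E \<and> E \<subseteq> B \<and> measure M E = \<Delta>"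
  obtains D where "D \<in> sets M" "\<And>s. s \<in> D \<Longrightarrow> 0 < f s" "measure M D \<le> \<Delta>"
    "\<Delta> * (\<integral>s. f s \<partial>M) \<le> measure M (space M) * (\<integral>s. f s * indicator D s \<partial>M)"
proof -
  have [measurable]: "f \<in> borel_measurable M" using f by simp
  define A where "A t = {s \<in> space M. t < f s}" for t
  have [measurable]: "A t \<in> sets M" for t unfolding A_def by measurable
  have A_antimono: "A t \<subseteq> A u" if "u \<le> t" for t u
    using that by (auto simp: A_def)
  define T where "T = {t. 0 \<le> t \<and> measure M (A t) \<le> \<Delta>}"
  \<comment> \<open>\<open>D\<close> is squeezed between the strict and the non-strict superlevel set of \<open>f\<close> at this level\<close>
  define \<tau> where "\<tau> = Inf T"
  have f_nonneg: "0 \<le> (\<integral>s. f s \<partial>M)" using f(2) by (rule Bochner_Integration.integral_nonneg)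
  \<comment> \<open>By Markov's inequality any level of at least the integral divided by
    \<open>\<Delta>\<close> belongs to \<open>T\<close>; adding 1 makes it positive even if the
    integral is 0.\<close>
  define t0 where "t0 = (\<integral>s. f s \<partial>M) / \<Delta> + 1"
  have "0 < t0" unfolding t0_def using f_nonneg \<Delta> by (simp add: add_nonneg_pos)
  have "measure M (A t0) \<le> measure M {s \<in> space M. t0 \<le> f s}"
    by (intro finite_measure_mono) (auto simp: A_def)
  also have "\<dots> \<le> (\<integral>s. f s \<partial>M) / t0"
    using integral_Markov_inequality_measure[OF f(1), of "{}" t0] f(2) \<open>0 < t0\<close> by simp
  also have "\<dots> \<le> \<Delta>"
    using \<open>0 < t0\<close> \<Delta> by (simp add: field_simps t0_def)
  finally have T: "T \<noteq> {}" "bdd_below T"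
    unfolding T_def using \<open>0 < t0\<close> by (auto intro!: exI[of _ t0] bdd_belowI[of _ 0])
  then have \<tau>_nonneg: "0 \<le> \<tau>" unfolding \<tau>_def by (intro cInf_greatest) (auto simp: T_def)
  have above: "measure M (A t) \<le> \<Delta>" if "\<tau> < t" for t
  proof -
    obtain u where "u \<in> T" "u < t" using cInf_lessD[OF T(1)] \<open>\<tau> < t\<close> unfolding \<tau>_def by blast
    then have "measure M (A t) \<le> measure M (A u)"
      by (intro finite_measure_mono) (auto simp: A_def)
    with \<open>u \<in> T\<close> show ?thesis by (simp add: T_def)
  qed
  \<comment> \<open>The level \<open>\<tau>\<close> itself belongs to \<open>T\<close>, by
    continuity from below along levels decreasing to \<open>\<tau>\<close>.\<close>
  have upper: "measure M (A \<tau>) \<le> \<Delta>"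
  proof -
    have "(\<lambda>n. measure M (A (\<tau> + 1 / real (Suc n)))) \<longlonglongrightarrow> measure M (\<Union>n. A (\<tau> + 1 / real (Suc n)))"
    proof (rule finite_Lim_measure_incseq)
      show "incseq (\<lambda>n. A (\<tau> + 1 / real (Suc n)))"
        by (intro incseq_SucI A_antimono) (simp add: frac_le)
    qed auto
    moreover have "(\<Union>n. A (\<tau> + 1 / real (Suc n))) = A \<tau>"
    proof (intro equalityI subsetI)
      fix s assume s: "s \<in> A \<tau>"
      then obtain n where "inverse (real (Suc n)) < f s - \<tau>"
        using reals_Archimedean[of "f s - \<tau>"] by (auto simp: A_def)
      with s show "s \<in> (\<Union>n. A (\<tau> + 1 / real (Suc n)))"
        by (auto simp: A_def inverse_eq_divide intro!: exI[of _ n])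
    next
      fix s assume "s \<in> (\<Union>n. A (\<tau> + 1 / real (Suc n)))"
      then obtain n where "s \<in> A (\<tau> + 1 / real (Suc n))" by blast
      then show "s \<in> A \<tau>" using A_antimono[of \<tau> "\<tau> + 1 / real (Suc n)"] by auto
    qed
    ultimately show ?thesis
      by (intro LIMSEQ_le_const2[where X = "\<lambda>n. measure M (A (\<tau> + 1 / real (Suc n)))"])
         (auto intro!: above)
  qed
  show ?thesis
  proof (cases "\<tau> = 0")
    \<comment> \<open>At level 0 the non-strict superlevel set is the whole space and may contain
      zeros of \<open>f\<close>, which \<open>D\<close> must avoid. Here \<open>A 0\<close> alone
      carries the full integral.\<close>
    case True
    have "(\<integral>s. f s * indicator (A 0) s \<partial>M) = (\<integral>s. f s \<partial>M)"
      using f(2) by (intro Bochner_Integration.integral_cong) (auto simp: A_def indicator_def less_le)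
    moreover have "\<Delta> * (\<integral>s. f s \<partial>M) \<le> measure M (space M) * (\<integral>s. f s \<partial>M)"
      using \<Delta> f_nonneg by (intro mult_right_mono) auto
    ultimately show ?thesis
      using True upper by (intro that[of "A 0"]) (auto simp: A_def)
  next
    case False
    with \<tau>_nonneg have \<tau>_pos: "0 < \<tau>" by simp
    define B where "B = {s \<in> space M. \<tau> \<le> f s}"
    have [measurable]: "B \<in> sets M" unfolding B_def by measurable
    have below: "\<Delta> < measure M (A t)" if "0 \<le> t" "t < \<tau>" for t
      using cInf_lower[OF _ T(2), of t] that unfolding \<tau>_def T_def by force
    have lower: "\<Delta> \<le> measure M B"
    proof -
      \<comment> \<open>These levels increase to \<open>\<tau>\<close> and start at
        \<open>u 0 = 0\<close>, hence remain in the range where \<open>below\<close>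
        applies.\<close>
      define u where "u n = \<tau> - \<tau> / real (Suc n)" for n
      have u: "0 \<le> u n" "u n < \<tau>" for n
        using \<tau>_pos unfolding u_def by (auto simp: field_simps)
      have "(\<lambda>n. measure M (A (u n))) \<longlonglongrightarrow> measure M (\<Inter>n. A (u n))"
      proof (rule finite_Lim_measure_decseq)
        have "u n \<le> u (Suc n)" for n
          using \<tau>_pos unfolding u_def by (simp add: frac_le)
        then show "decseq (\<lambda>n. A (u n))"
          by (intro decseq_SucI A_antimono)
      qed auto
      moreover have "(\<Inter>n. A (u n)) = B"
      proof (intro equalityI subsetI)
        fix s assume s: "s \<in> (\<Inter>n. A (u n))"
        have "u \<longlonglongrightarrow> \<tau> - 0"
          unfolding u_def
          by (intro tendsto_intros LIMSEQ_Suc[OF lim_const_over_n])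
        moreover have "u n \<le> f s" for n using s by (auto simp: A_def intro: less_imp_le)
        ultimately have "\<tau> - 0 \<le> f s" by (intro LIMSEQ_le_const2[where X = u]) auto
        with s show "s \<in> B" by (auto simp: A_def B_def)
      qed (use u in \<open>auto simp: A_def B_def intro: less_le_trans\<close>)
      ultimately show ?thesis
        by (intro LIMSEQ_le_const[where X = "\<lambda>n. measure M (A (u n))"])
           (auto intro!: less_imp_le below u)
    qed
    have "A \<tau> \<subseteq> B" by (auto simp: A_def B_def)
    then obtain D where D: "D \<in> sets M" "A \<tau> \<subseteq> D" "D \<subseteq> B" "measure M D = \<Delta>"
      using intermediate[of "A \<tau>" B] upper lower by auto
    note [measurable] = D(1)
    have int: "integrable M (\<lambda>s. f s * indicator D s)"
      using integrable_real_mult_indicator[OF D(1) f(1)] .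
    have intc: "integrable M (\<lambda>s. f s * indicator (space M - D) s)"
      using integrable_real_mult_indicator[OF _ f(1), of "space M - D"] by simp
    have ge: "\<tau> * \<Delta> \<le> (\<integral>s. f s * indicator D s \<partial>M)"
    proof -
      have "(\<integral>s. \<tau> * indicator D s \<partial>M) \<le> (\<integral>s. f s * indicator D s \<partial>M)"
      proof (rule integral_mono[OF _ int])
        show "integrable M (\<lambda>s. \<tau> * indicator D s)" by (simp add: less_top[symmetric])
      qed (use D in \<open>auto simp: B_def indicator_def\<close>)
      then show ?thesis using D by simp
    qed
    have le: "(\<integral>s. f s * indicator (space M - D) s \<partial>M) \<le> \<tau> * (measure M (space M) - \<Delta>)"
    proof -
      have "(\<integral>s. f s * indicator (space M - D) s \<partial>M) \<le> (\<integral>s. \<tau> * indicator (space M - D) s \<partial>M)"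
      proof (rule integral_mono[OF intc])
        show "integrable M (\<lambda>s. \<tau> * indicator (space M - D) s)" by (simp add: less_top[symmetric])
      qed (use D in \<open>auto simp: A_def indicator_def not_less\<close>)
      then show ?thesis using D by (simp add: finite_measure_compl)
    qed
    have "(\<integral>s. f s \<partial>M) = (\<integral>s. f s * indicator D s + f s * indicator (space M - D) s \<partial>M)"
      by (intro Bochner_Integration.integral_cong) (auto simp: indicator_def)
    also have "\<dots> = (\<integral>s. f s * indicator D s \<partial>M) + (\<integral>s. f s * indicator (space M - D) s \<partial>M)"
      by (rule Bochner_Integration.integral_add[OF int intc])
    finally have split: "(\<integral>s. f s \<partial>M) = \<dots>" .
    \<comment> \<open>Both \<open>le\<close> and \<open>ge\<close> compare with
      \<open>\<tau> * \<Delta> * (measure M (space M) - \<Delta>)\<close>; adding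
      \<open>\<Delta>\<close> times the integral over \<open>D\<close> then gives the claim.\<close>
    have "\<Delta> * (\<integral>s. f s * indicator (space M - D) s \<partial>M) \<le> \<Delta> * (\<tau> * (measure M (space M) - \<Delta>))"
      using le \<Delta> by (intro mult_left_mono) auto
    also have "\<dots> = (measure M (space M) - \<Delta>) * (\<tau> * \<Delta>)" by simp
    also have "\<dots> \<le> (measure M (space M) - \<Delta>) * (\<integral>s. f s * indicator D s \<partial>M)"
      using ge \<Delta> by (intro mult_left_mono) auto
    finally have "\<Delta> * (\<integral>s. f s \<partial>M) \<le> measure M (space M) * (\<integral>s. f s * indicator D s \<partial>M)"
      unfolding split by (simp add: algebra_simps)
    moreover have "0 < f s" if "s \<in> D" for s using D \<tau>_pos that by (auto simp: B_def)
    ultimately show ?thesis using that[of D] D by auto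
  qed
qed

section \<open>Weak-* accumulation points\<close>

text \<open>For a uniformly bounded sequence the good test functions form an L1-closed linear space.
  Dynkin's theorem extends the convergence from the generator to all measurable sets, and density of
  simple functions extends it to L1. The whole space is tested separately because \<open>E\<close>
  need not contain it and complements refer to it.\<close>

lemma tendsto_integral_product_0:
  fixes y :: "nat \<Rightarrow> 'a \<Rightarrow> real"
  assumes M: "finite_measure M"
    and E: "Int_stable E" "E \<subseteq> Pow (space M)" "sets M = sigma_sets (space M) E"
    and y: "\<And>k. y k \<in> borel_measurable M" "\<And>k. AE s in M. \<bar>y k s\<bar> \<le> c"
    and lim: "\<And>A. A \<in> insert (space M) E \<Longrightarrow> (\<lambda>k. \<integral>s. y k s * indicator A s \<partial>M) \<longlonglongrightarrow> 0"
    and "integrable M \<phi>"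
  shows "(\<lambda>k. \<integral>s. y k s * \<phi> s \<partial>M) \<longlonglongrightarrow> 0"
proof -
  interpret finite_measure M by (rule M)
  note [measurable] = y(1)
  have prod_int: "integrable M (\<lambda>s. y k s * f s)"
    and prod_le: "\<bar>\<integral>s. y k s * f s \<partial>M\<bar> \<le> \<bar>c\<bar> * (\<integral>s. \<bar>f s\<bar> \<partial>M)" if f: "integrable M f" for f k
  proof -
    have bd: "AE s in M. norm (y k s * f s) \<le> \<bar>c\<bar> * \<bar>f s\<bar>"
      using y(2)[of k] by eventually_elim (auto simp: abs_mult intro!: mult_right_mono)
    have [measurable]: "f \<in> borel_measurable M" using f by simp
    have cf: "integrable M (\<lambda>s. \<bar>c\<bar> * \<bar>f s\<bar>)" using f by simp
    show "integrable M (\<lambda>s. y k s * f s)"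
      by (rule Bochner_Integration.integrable_bound[OF cf]) (use bd in auto)
    then have "(\<integral>s. \<bar>y k s * f s\<bar> \<partial>M) \<le> (\<integral>s. \<bar>c\<bar> * \<bar>f s\<bar> \<partial>M)"
      using bd cf by (intro integral_mono_AE) auto
    then show "\<bar>\<integral>s. y k s * f s \<partial>M\<bar> \<le> \<bar>c\<bar> * (\<integral>s. \<bar>f s\<bar> \<partial>M)"
      using integral_abs_bound[of M "\<lambda>s. y k s * f s"] by (simp only: integral_mult_right_zero)
  qed
  define P where "P f \<longleftrightarrow> (\<lambda>k. \<integral>s. y k s * f s \<partial>M) \<longlonglongrightarrow> 0" for f
  \<comment> \<open>\<open>P\<close> is closed under \<open>L\<^sup>1\<close> limits, as the \<open>y k\<close> are uniformly bounded\<close>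
  have closed: "P f" if f: "integrable M f" and g: "\<And>i. integrable M (g i)" "\<And>i. P (g i)"
    and conv: "(\<lambda>i. \<integral>s. \<bar>f s - g i s\<bar> \<partial>M) \<longlonglongrightarrow> 0" for f and g :: "nat \<Rightarrow> 'a \<Rightarrow> real"
    unfolding P_def
  proof (rule LIMSEQ_I)
    fix e :: real assume e: "0 < e"
    have "(\<lambda>i. \<bar>c\<bar> * (\<integral>s. \<bar>f s - g i s\<bar> \<partial>M)) \<longlonglongrightarrow> \<bar>c\<bar> * 0"
      by (intro tendsto_intros conv)
    then have "\<forall>\<^sub>F i in sequentially. \<bar>c\<bar> * (\<integral>s. \<bar>f s - g i s\<bar> \<partial>M) < e/2"
      using e by (intro order_tendstoD(2)) auto
    then obtain i where i: "\<bar>c\<bar> * (\<integral>s. \<bar>f s - g i s\<bar> \<partial>M) < e/2"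
      by (auto simp: eventually_sequentially)
    obtain N where N: "\<And>k. N \<le> k \<Longrightarrow> \<bar>\<integral>s. y k s * g i s \<partial>M\<bar> < e/2"
      using LIMSEQ_D[OF g(2)[of i, unfolded P_def], of "e/2"] e by auto
    have "\<bar>\<integral>s. y k s * f s \<partial>M\<bar> < e" if "N \<le> k" for k
    proof -
      have fg: "integrable M (\<lambda>s. f s - g i s)" using f g by auto
      have "(\<integral>s. y k s * f s \<partial>M) = (\<integral>s. y k s * g i s + y k s * (f s - g i s) \<partial>M)"
        by (simp add: algebra_simps)
      also have "\<dots> = (\<integral>s. y k s * g i s \<partial>M) + (\<integral>s. y k s * (f s - g i s) \<partial>M)"
        by (intro Bochner_Integration.integral_add prod_int g fg)
      finally show ?thesis using N[OF that] prod_le[OF fg, of k] i by linarith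
    qed
    then show "\<exists>N. \<forall>k\<ge>N. norm ((\<integral>s. y k s * f s \<partial>M) - 0) < e" by auto
  qed
  have ind: "integrable M (indicator A :: 'a \<Rightarrow> real)" if "A \<in> sets M" for A
    using that by (simp add: less_top[symmetric])
  \<comment> \<open>In the union case finite partial unions are handled by linearity, and they
    converge to the full union in L1.\<close>
  have set: "P (indicator A)" if "A \<in> sets M" for A
    using E(1,2) that[unfolded E(3)]
  proof (induction A rule: sigma_sets_induct_disjoint)
    case (basic A)
    then show ?case using lim by (auto simp: P_def)
  next
    case empty
    then show ?case by (simp add: P_def)
  next
    case (compl A)
    have A: "A \<in> sets M" using compl E(3) by simp
    have "(\<integral>s. y k s * indicator (space M - A) s \<partial>M)
        = (\<integral>s. y k s * indicator (space M) s \<partial>M) - (\<integral>s. y k s * indicator A s \<partial>M)" for k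
    proof -
      have "(\<integral>s. y k s * indicator (space M - A) s \<partial>M)
          = (\<integral>s. y k s * indicator (space M) s - y k s * indicator A s \<partial>M)"
        by (intro Bochner_Integration.integral_cong) (auto simp: indicator_def)
      then show ?thesis
        using prod_int[OF ind[OF A]] prod_int[OF ind[OF sets.top]]
        by (simp add: Bochner_Integration.integral_diff)
    qed
    then show ?case
      using tendsto_diff[OF lim[of "space M"] compl(2)[unfolded P_def]] by (simp add: P_def)
  next
    case (union A)
    have A: "A i \<in> sets M" for i using union E(3) by auto
    define g where "g i s = (\<Sum>j<i. indicator (A j) s :: real)" for i s
    have g_int: "integrable M (g i)" for i
      unfolding g_def using ind[OF A] by auto
    have "P (g i)" for i
    proof -
      have "(\<integral>s. y k s * g i s \<partial>M) = (\<Sum>j<i. \<integral>s. y k s * indicator (A j) s \<partial>M)" for k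
        unfolding g_def sum_distrib_left
        by (intro Bochner_Integration.integral_sum prod_int ind A)
      moreover have "(\<lambda>k. \<Sum>j<i. \<integral>s. y k s * indicator (A j) s \<partial>M) \<longlonglongrightarrow> (\<Sum>j<i. 0)"
        using union(3) by (intro tendsto_sum) (simp add: P_def)
      ultimately show ?thesis by (simp add: P_def)
    qed
    moreover have "(\<lambda>i. \<integral>s. \<bar>indicator (\<Union>i. A i) s - g i s\<bar> \<partial>M) \<longlonglongrightarrow> (\<integral>s. 0 \<partial>M)"
    proof (rule integral_dominated_convergence)
      \<comment> \<open>Disjointness turns the partial sum into an indicator, which provides the
        dominating constant 1.\<close>
      have g_eq: "g i s = indicator (\<Union>j<i. A j) s" for i s
        unfolding g_def using union(1)
        by (subst indicator_UN_disjoint) (auto simp: disjoint_family_on_def)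
      show "AE s in M. (\<lambda>i. \<bar>indicator (\<Union>i. A i) s - g i s\<bar>) \<longlonglongrightarrow> 0"
        unfolding g_eq
      proof (intro AE_I2 tendsto_rabs_zero)
        fix s
        show "(\<lambda>i. indicator (\<Union>i. A i) s - indicator (\<Union>j<i. A j) s :: real) \<longlonglongrightarrow> 0"
          using tendsto_diff[OF tendsto_const LIMSEQ_indicator_UN[of A s],
            where a = "indicator (\<Union>i. A i) s :: real"] by simp
      qed
      show "AE s in M. norm \<bar>indicator (\<Union>i. A i) s - g i s\<bar> \<le> 1" for i
        unfolding g_eq by (auto simp: indicator_def)
    qed (use g_int A in \<open>auto intro!: borel_measurable_integrable\<close>)
    ultimately show ?case
      using closed[of "indicator (\<Union>i. A i)" g] g_int ind[of "\<Union>i. A i"] A by auto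
  qed
  from \<open>integrable M \<phi>\<close> have "P \<phi>"
  proof (induct rule: integrable_induct)
    case (base A v)
    have "(\<lambda>k. (\<integral>s. y k s * indicator A s \<partial>M) * v) \<longlonglongrightarrow> 0 * v"
      using set[OF base(1)] unfolding P_def by (intro tendsto_intros)
    then show ?case by (simp add: P_def mult.assoc[symmetric])
  next
    case (add f g)
    have "(\<integral>s. y k s * (f s + g s) \<partial>M) = (\<integral>s. y k s * f s \<partial>M) + (\<integral>s. y k s * g s \<partial>M)" for k
      unfolding distrib_left using add by (intro Bochner_Integration.integral_add prod_int)
    with tendsto_add[OF add(2,4)[unfolded P_def]] show ?case by (simp add: P_def)
  next
    case (lim f g)
    have "(\<lambda>i. \<integral>s. \<bar>f s - g i s\<bar> \<partial>M) \<longlonglongrightarrow> (\<integral>s. 0 \<partial>M)"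
    proof (rule integral_dominated_convergence)
      show "AE s in M. (\<lambda>i. \<bar>f s - g i s\<bar>) \<longlonglongrightarrow> 0"
      proof (intro AE_I2 tendsto_rabs_zero)
        fix s assume "s \<in> space M"
        from tendsto_diff[OF tendsto_const[of "f s"] lim(3)[OF this]]
        show "(\<lambda>i. f s - g i s) \<longlonglongrightarrow> 0" by simp
      qed
      \<comment> \<open>The simple approximations satisfy
        \<open>\<bar>g i s\<bar> \<le> 2 * \<bar>f s\<bar>\<close>, so the difference is dominated
        by three times \<open>\<bar>f s\<bar>\<close>.\<close>
      show "integrable M (\<lambda>s. 3 * \<bar>f s\<bar>)" using lim(5) by simp
      show "AE s in M. norm \<bar>f s - g i s\<bar> \<le> 3 * \<bar>f s\<bar>" for i
      proof (rule AE_I2)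
        fix s assume "s \<in> space M"
        from lim(4)[OF this, of i] show "norm \<bar>f s - g i s\<bar> \<le> 3 * \<bar>f s\<bar>" by simp
      qed
      show "(\<lambda>s. \<bar>f s - g i s\<bar>) \<in> borel_measurable M" for i
        using lim(1)[of i] lim(5) by measurable
    qed simp
    then show ?case by (intro closed[of f g] lim(1,2,5)) simp
  qed
  then show ?thesis by (simp add: P_def)
qed

text \<open>A cluster point need not be the limit of a subsequence in a general topology. For a
  uniformly bounded sequence, however, countably many test functions, the indicators of the
  generator and of the whole space, decide convergence, so shrinking neighbourhoods can be chosen
  diagonally.\<close>

lemma weak_star_accumulation_point_subseq:
  fixes xs :: "nat \<Rightarrow> 'a \<Rightarrow> real"
  assumes M: "finite_measure M"
    and E: "countable E" "Int_stable E" "E \<subseteq> Pow (space M)" "sets M = sigma_sets (space M) E"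
    and xs: "\<And>k. xs k \<in> borel_measurable M" "\<And>k. AE s in M. \<bar>xs k s\<bar> \<le> c"
    and acc: "accumulation_point (weak_star_topology M) xs x"
  obtains r where "strict_mono r"
    "\<And>\<phi>. integrable M \<phi> \<Longrightarrow> (\<lambda>k. \<integral>s. xs (r k) s * \<phi> s \<partial>M) \<longlonglongrightarrow> (\<integral>s. x s * \<phi> s \<partial>M)"
proof -
  interpret finite_measure M by (rule M)
  have "x \<in> space_Linf M"
    using acc by (auto simp: accumulation_point_def weak_star_topology_def)
  then obtain b where x[measurable]: "x \<in> borel_measurable M" and xb: "AE s in M. \<bar>x s\<bar> \<le> b"
    by (auto simp: space_Linf_def)
  note [measurable] = xs(1)
  \<comment> \<open>The enumeration may repeat sets; inserting the whole space also makes it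
    nonempty.\<close>
  define e where "e = from_nat_into (insert (space M) E)"
  have range_e: "range e = insert (space M) E"
    unfolding e_def using E(1) by (intro range_from_nat_into) auto
  have e_sets[measurable]: "e i \<in> sets M" for i
  proof -
    have "e i \<in> insert (space M) E" using range_e by blast
    then show ?thesis using E(4) by auto
  qed
  have ind: "integrable M (indicator A :: 'a \<Rightarrow> real)" if "A \<in> sets M" for A
    using that by (simp add: less_top[symmetric])
  define W where "W i k = {f \<in> space_Linf M.
    (\<integral>s. f s * indicator (e i) s \<partial>M) \<in> ball (\<integral>s. x s * indicator (e i) s \<partial>M) (1 / real (Suc k))}"
    for i k
  \<comment> \<open>\<open>V k\<close> controls the tests \<open>0\<close> to \<open>k\<close> with
    tolerance \<open>1 / real (Suc k)\<close>, so a subsequence with \<open>xs (r k)\<close> in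
    \<open>V k\<close> passes each test \<open>i\<close> from \<open>k = i\<close> on.\<close>
  define V where "V k = (\<Inter>i\<in>{..k}. W i k)" for k
  have open_W: "openin (weak_star_topology M) (W i k)" for i k
    unfolding weak_star_topology_def openin_topology_generated_by_iff W_def
  proof (intro generate_topology_on.Basis CollectI exI conjI)
    show "indicator (e i) \<in> space_L1 M" using ind[OF e_sets] by (simp add: space_L1_def)
  qed (rule refl open_ball)+
  have "openin (weak_star_topology M) (V k)" for k
    unfolding V_def by (intro openin_Inter) (auto intro: open_W)
  moreover have "x \<in> V k" for k
    using \<open>x \<in> space_Linf M\<close> by (auto simp: V_def W_def)
  ultimately have inf: "\<exists>\<^sub>F n in sequentially. xs n \<in> V k" for k
    using acc unfolding accumulation_point_def by blast
  have inf': "\<exists>n>m. xs n \<in> V k" for m k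
    using inf[of k] unfolding frequently_sequentially by (meson Suc_le_eq)
  \<comment> \<open>Each \<open>V k\<close> is visited at arbitrarily late indices, so the choices
    can be made strictly increasing.\<close>
  obtain r where r: "\<And>k. xs (r k) \<in> V k" "\<And>k. r k < r (Suc k)"
    using dependent_nat_choice[of "\<lambda>k n. xs n \<in> V k" "\<lambda>_ n n'. n < n'"] inf'
    by (metis (no_types, lifting))
  have "strict_mono r" using r(2) by (simp add: strict_mono_Suc_iff)
  moreover have "(\<lambda>k. \<integral>s. xs (r k) s * \<phi> s \<partial>M) \<longlonglongrightarrow> (\<integral>s. x s * \<phi> s \<partial>M)"
    if \<phi>: "integrable M \<phi>" for \<phi>
  proof -
    have prod_int: "integrable M (\<lambda>s. z s * f s)"
      if "z \<in> borel_measurable M" "AE s in M. \<bar>z s\<bar> \<le> d" "integrable M f" for z f :: "'a \<Rightarrow> real" and d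
    proof (rule Bochner_Integration.integrable_bound)
      show "integrable M (\<lambda>s. \<bar>d\<bar> * \<bar>f s\<bar>)" using that by simp
      show "AE s in M. norm (z s * f s) \<le> norm (\<bar>d\<bar> * \<bar>f s\<bar>)"
        using that(2) by eventually_elim (auto simp: abs_mult intro!: mult_right_mono)
    qed (use that in auto)
    have diff: "(\<integral>s. (xs (r k) s - x s) * f s \<partial>M) = (\<integral>s. xs (r k) s * f s \<partial>M) - (\<integral>s. x s * f s \<partial>M)"
      if "integrable M f" for f k
      unfolding left_diff_distrib
      by (intro Bochner_Integration.integral_diff prod_int[OF xs that] prod_int[OF x xb that])
    have "(\<lambda>k. \<integral>s. (xs (r k) s - x s) * \<phi> s \<partial>M) \<longlonglongrightarrow> 0"
    proof (rule tendsto_integral_product_0[OF M E(2-4) _ _ _ \<phi>])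
      show "AE s in M. \<bar>xs (r k) s - x s\<bar> \<le> c + b" for k
        using xs(2)[of "r k"] xb by eventually_elim auto
    next
      fix A assume "A \<in> insert (space M) E"
      then obtain i where A: "A = e i" unfolding range_e[symmetric] by auto
      have "(\<lambda>k. 1 / real (Suc k)) \<longlonglongrightarrow> 0" using LIMSEQ_Suc[OF lim_1_over_n] by simp
      moreover have "norm (\<integral>s. (xs (r k) s - x s) * indicator (e i) s \<partial>M) \<le> 1 / real (Suc k)"
        if "i \<le> k" for k
      proof -
        have "xs (r k) \<in> W i k" using r(1)[of k] that by (auto simp: V_def)
        then show ?thesis
          unfolding diff[OF ind[OF e_sets]] by (simp add: W_def dist_real_def abs_minus_commute)
      qed
      ultimately show "(\<lambda>k. \<integral>s. (xs (r k) s - x s) * indicator A s \<partial>M) \<longlonglongrightarrow> 0"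
        unfolding A
        by (elim Lim_null_comparison[rotated] eventually_sequentiallyI)
    qed auto
    then show ?thesis unfolding diff[OF \<phi>] by (rule LIM_zero_cancel)
  qed
  ultimately show ?thesis by (rule that)
qed

section \<open>Descent estimates\<close>

lemma Cauchy_Schwarz_L2:
  assumes "f \<in> space_L2 M" "g \<in> space_L2 M"
  shows "integrable M (\<lambda>s. f s * g s)"
    and "(\<integral>s. \<bar>f s * g s\<bar> \<partial>M) \<le> norm_L2 M f * norm_L2 M g"
proof -
  have [measurable]: "f \<in> borel_measurable M" "g \<in> borel_measurable M"
    and sq: "integrable M (\<lambda>s. (f s)\<^sup>2)" "integrable M (\<lambda>s. (g s)\<^sup>2)"
    using assms by (auto simp: space_L2_def)
  show int: "integrable M (\<lambda>s. f s * g s)"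
  proof (rule Bochner_Integration.integrable_bound)
    show "integrable M (\<lambda>s. (f s)\<^sup>2 + (g s)\<^sup>2)" using sq by simp
    have "\<bar>a * b\<bar> \<le> a\<^sup>2 + b\<^sup>2" for a b :: real
      using sum_squares_bound[of "\<bar>a\<bar>" "\<bar>b\<bar>"] abs_ge_zero[of "a * b"]
      by (simp only: abs_mult power2_abs)
    then show "AE s in M. norm (f s * g s) \<le> norm ((f s)\<^sup>2 + (g s)\<^sup>2)" by simp
  qed measurable
  have "(\<integral>\<^sup>+s. ennreal \<bar>f s\<bar> * ennreal \<bar>g s\<bar> \<partial>M)\<^sup>2
      \<le> (\<integral>\<^sup>+s. ennreal \<bar>f s\<bar> ^ 2 \<partial>M) * (\<integral>\<^sup>+s. ennreal \<bar>g s\<bar> ^ 2 \<partial>M)"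
    by (rule Cauchy_Schwarz_nn_integral) measurable
  also have "(\<integral>\<^sup>+s. ennreal \<bar>f s\<bar> * ennreal \<bar>g s\<bar> \<partial>M) = ennreal (\<integral>s. \<bar>f s * g s\<bar> \<partial>M)"
    using integrable_abs[OF int]
    by (subst nn_integral_eq_integral[symmetric]) (auto simp: abs_mult ennreal_mult)
  also have "(\<integral>\<^sup>+s. ennreal \<bar>f s\<bar> ^ 2 \<partial>M) = ennreal (\<integral>s. (f s)\<^sup>2 \<partial>M)"
    using sq by (subst nn_integral_eq_integral[symmetric]) (auto simp: ennreal_power)
  also have "(\<integral>\<^sup>+s. ennreal \<bar>g s\<bar> ^ 2 \<partial>M) = ennreal (\<integral>s. (g s)\<^sup>2 \<partial>M)"
    using sq by (subst nn_integral_eq_integral[symmetric]) (auto simp: ennreal_power)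
  finally have "(\<integral>s. \<bar>f s * g s\<bar> \<partial>M)\<^sup>2 \<le> (\<integral>s. (f s)\<^sup>2 \<partial>M) * (\<integral>s. (g s)\<^sup>2 \<partial>M)"
    by (simp add: ennreal_power ennreal_mult[symmetric])
  then show "(\<integral>s. \<bar>f s * g s\<bar> \<partial>M) \<le> norm_L2 M f * norm_L2 M g"
    unfolding norm_L2_def real_sqrt_mult[symmetric] by (rule real_le_rsqrt)
qed


text \<open>The Lipschitz constant is fixed here so that it can appear in explicit bounds. The
  measure is an arbitrary finite one; the existence of subsets of prescribed measure is a separate
  hypothesis of the lemmas about steps.\<close>

locale L1_smooth_functional = finite_measure M for M :: "'a measure" +
  fixes J :: "('a \<Rightarrow> real) \<Rightarrow> real" and G :: "('a \<Rightarrow> real) \<Rightarrow> 'a \<Rightarrow> real" and L :: real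
  assumes gradient: "is_gradient M J G"
    and G_L2: "x \<in> space_L1 M \<Longrightarrow> G x \<in> space_L2 M"
    and L_nonneg: "0 \<le> L"
    and G_lipschitz: "x \<in> space_L1 M \<Longrightarrow> y \<in> space_L1 M \<Longrightarrow>
      norm_L2 M (\<lambda>s. G x s - G y s) \<le> L * norm_L1 M (\<lambda>s. x s - y s)"
begin

section \<open>Gradients and indicators in L1 and L2\<close>

lemma G_measurable: "x \<in> space_L1 M \<Longrightarrow> G x \<in> borel_measurable M"
  using G_L2 by (simp add: space_L2_def)

lemma G_integrable: "x \<in> space_L1 M \<Longrightarrow> integrable M (G x)"
  by (rule square_integrable_imp_integrable) (use G_L2[of x] in \<open>simp_all add: space_L2_def\<close>)

lemma G_diff_L2:
  assumes "x \<in> space_L1 M" "y \<in> space_L1 M"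
  shows "(\<lambda>s. G x s - G y s) \<in> space_L2 M"
proof -
  have G: "G x \<in> space_L2 M" "G y \<in> space_L2 M" using assms by (simp_all add: G_L2)
  have sq: "integrable M (\<lambda>s. (G x s)\<^sup>2)" "integrable M (\<lambda>s. (G y s)\<^sup>2)"
    using G by (simp_all add: space_L2_def)
  have expand: "(\<lambda>s. (G x s - G y s)\<^sup>2) = (\<lambda>s. (G x s)\<^sup>2 - 2 * (G x s * G y s) + (G y s)\<^sup>2)"
    by (rule ext) (simp add: power2_eq_square algebra_simps)
  have "integrable M (\<lambda>s. (G x s - G y s)\<^sup>2)"
    unfolding expand
    by (intro Bochner_Integration.integrable_add Bochner_Integration.integrable_diff
        integrable_mult_right sq Cauchy_Schwarz_L2(1)[OF G])
  then show ?thesis using G_measurable assms by (simp add: space_L2_def)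
qed

lemma indicator_L1: "A \<in> sets M \<Longrightarrow> indicator A \<in> space_L1 M"
  by (simp add: space_L1_def less_top[symmetric])

lemma indicator_square: "(indicator A s :: real)\<^sup>2 = indicator A s"
  by (simp add: indicator_def)

lemma indicator_L2: "A \<in> sets M \<Longrightarrow> indicator A \<in> space_L2 M"
  by (simp add: space_L2_def indicator_square less_top[symmetric])

lemma norm_L2_indicator: "A \<in> sets M \<Longrightarrow> norm_L2 M (indicator A) = sqrt (measure M A)"
  by (simp add: norm_L2_def indicator_square)

text \<open>Source of all the square roots: an L2 bound controls the integral over a set only
  through the root of its measure. This gives the exponent 3/2 of the model error and the Hoelder
  exponent 1/2 of the criticality.\<close>

lemma integral_abs_mult_indicator_le:
  assumes "f \<in> space_L2 M" "A \<in> sets M"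
  shows "(\<integral>s. \<bar>f s\<bar> * indicator A s \<partial>M) \<le> norm_L2 M f * sqrt (measure M A)"
  using Cauchy_Schwarz_L2(2)[OF assms(1) indicator_L2[OF assms(2)]] assms(2)
  by (simp add: norm_L2_indicator abs_mult)

section \<open>Mean value theorem and model error\<close>

lemma has_real_derivative_along_line:
  assumes x: "x \<in> space_L1 M" and h: "h \<in> space_L1 M"
  shows "((\<lambda>t. J (\<lambda>s. x s + t * h s)) has_real_derivative
    (\<integral>s. G (\<lambda>s. x s + t * h s) s * h s \<partial>M)) (at t)"
  unfolding DERIV_def
proof (rule LIM_I)
  fix r :: real assume r: "0 < r"
  define z where "z s = x s + t * h s" for s
  have z: "z \<in> space_L1 M" using x h by (simp add: space_L1_def z_def[abs_def])
  define N where "N = norm_L1 M h"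
  have N: "0 \<le> N" unfolding N_def norm_L1_def by simp
  have norm_scale: "norm_L1 M (\<lambda>s. u * h s) = \<bar>u\<bar> * N" for u
    unfolding N_def norm_L1_def by (simp add: abs_mult)
  \<comment> \<open>Using \<open>N + 1\<close> instead of \<open>N\<close> covers directions of norm
    0 and leaves room for a strict final inequality.\<close>
  have "0 < r / (N + 1)" using r N by simp
  then obtain d where d: "0 < d" "\<And>k. k \<in> space_L1 M \<Longrightarrow> norm_L1 M k < d \<Longrightarrow>
      \<bar>J (\<lambda>s. z s + k s) - J z - (\<integral>s. G z s * k s \<partial>M)\<bar> \<le> r / (N + 1) * norm_L1 M k"
    using gradient z unfolding is_gradient_def has_L1_derivative_def by meson
  have "\<bar>(J (\<lambda>s. x s + (t + u) * h s) - J z) / u - (\<integral>s. G z s * h s \<partial>M)\<bar> < r"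
    if u: "u \<noteq> 0" "\<bar>u\<bar> < d / (N + 1)" for u
  proof -
    have "\<bar>u\<bar> * N \<le> \<bar>u\<bar> * (N + 1)" by (intro mult_left_mono) auto
    also have "\<dots> < d" using u N by (simp add: field_simps)
    finally have "\<bar>J (\<lambda>s. z s + u * h s) - J z - (\<integral>s. G z s * (u * h s) \<partial>M)\<bar> \<le> r / (N + 1) * (\<bar>u\<bar> * N)"
      using d(2)[of "\<lambda>s. u * h s"] h by (simp add: norm_scale space_L1_def)
    also have "(\<lambda>s. z s + u * h s) = (\<lambda>s. x s + (t + u) * h s)"
      by (auto simp: z_def algebra_simps)
    also have "(\<integral>s. G z s * (u * h s) \<partial>M) = u * (\<integral>s. G z s * h s \<partial>M)"
      by (simp add: mult.left_commute)
    finally have "\<bar>J (\<lambda>s. x s + (t + u) * h s) - J z - u * (\<integral>s. G z s * h s \<partial>M)\<bar> \<le> \<bar>u\<bar> * (r / (N + 1) * N)"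
      by (simp add: algebra_simps)
    also have "\<bar>J (\<lambda>s. x s + (t + u) * h s) - J z - u * (\<integral>s. G z s * h s \<partial>M)\<bar>
      = \<bar>u * ((J (\<lambda>s. x s + (t + u) * h s) - J z) / u - (\<integral>s. G z s * h s \<partial>M))\<bar>"
      using u(1)
      by (subst right_diff_distrib) simp
    finally have "\<bar>(J (\<lambda>s. x s + (t + u) * h s) - J z) / u - (\<integral>s. G z s * h s \<partial>M)\<bar> \<le> r / (N + 1) * N"
      unfolding abs_mult by (rule mult_left_le_imp_le) (use u(1) in simp)
    also have "\<dots> < r" using r N by (simp add: field_simps)
    finally show ?thesis .
  qed
  moreover have "0 < d / (N + 1)" using d(1) N by simp
  ultimately show "\<exists>e>0. \<forall>u. u \<noteq> 0 \<and> norm (u - 0) < e \<longrightarrow>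
      norm ((J (\<lambda>s. x s + (t + u) * h s) - J (\<lambda>s. x s + t * h s)) / u
        - (\<integral>s. G (\<lambda>s. x s + t * h s) s * h s \<partial>M)) < r"
    unfolding z_def[abs_def] real_norm_def diff_0_right by blast
qed

lemma mean_value:
  assumes x: "x \<in> space_L1 M" and h: "h \<in> space_L1 M"
  obtains \<xi> where "0 < \<xi>" "\<xi> < 1"
    "J (\<lambda>s. x s + h s) - J x = (\<integral>s. G (\<lambda>s. x s + \<xi> * h s) s * h s \<partial>M)"
proof -
  obtain \<xi> :: real where "0 < \<xi>" "\<xi> < 1"
    "J (\<lambda>s. x s + 1 * h s) - J (\<lambda>s. x s + 0 * h s)
      = (1 - 0) * (\<integral>s. G (\<lambda>s. x s + \<xi> * h s) s * h s \<partial>M)"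
    using MVT2[OF zero_less_one has_real_derivative_along_line[OF x h]] by blast
  then show ?thesis by (intro that) simp_all
qed

text \<open>The mean value theorem writes the error as the gradient difference between an
  intermediate point and \<open>indicator U\<close>, integrated against the change of the indicator.
  The gradients differ in L2 by at most \<open>L * measure M D\<close>, and Cauchy-Schwarz on
  \<open>D\<close> adds the square root.\<close>

lemma abs_actual_minus_predicted_le:
  assumes U: "U \<in> sets M" and D: "D \<in> sets M"
  shows "\<bar>actual_change J U D - predicted_change M G U D\<bar> \<le> L * (measure M D * sqrt (measure M D))"
proof -
  \<comment> \<open>The signed change of the indicator; it is the increment of the actual change and
    the direction tested in the prediction.\<close>
  define d :: "'a \<Rightarrow> real" where "d s = indicator (D - U) s - indicator (U \<inter> D) s" for s
  have abs_d: "\<bar>d s\<bar> = indicator D s" for s by (auto simp: d_def indicator_def)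
  have d[measurable]: "d \<in> borel_measurable M" using U D unfolding d_def by measurable
  have d_L1: "d \<in> space_L1 M"
    using indicator_L1[OF D] unfolding space_L1_def
    by (auto intro: Bochner_Integration.integrable_bound simp: abs_d)
  have chi: "indicator (sym_diff U D) = (\<lambda>s. indicator U s + d s)"
    by (auto simp: d_def indicator_def)
  obtain \<xi> where \<xi>: "0 < \<xi>" "\<xi> < 1"
    "actual_change J U D = (\<integral>s. G (\<lambda>s. indicator U s + \<xi> * d s) s * d s \<partial>M)"
    using mean_value[OF indicator_L1[OF U] d_L1] unfolding actual_change_def chi by auto
  define z where "z s = indicator U s + \<xi> * d s" for s
  have z: "z \<in> space_L1 M" using d_L1 indicator_L1[OF U] by (simp add: z_def[abs_def] space_L1_def)
  have Gd: "integrable M (\<lambda>s. G y s * d s)" if "y \<in> space_L1 M" for y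
    using integrable_mult_indicator[OF D G_integrable[OF that]] G_measurable[OF that]
    by (auto elim!: Bochner_Integration.integrable_bound simp: abs_mult abs_d)
  have "actual_change J U D - predicted_change M G U D = (\<integral>s. (G z s - G (indicator U) s) * d s \<partial>M)"
    using Gd[OF z] Gd[OF indicator_L1[OF U]]
    unfolding \<xi>(3) z_def[abs_def, symmetric] predicted_change_def inner_L2_def d_def[symmetric] left_diff_distrib
    by (simp add: Bochner_Integration.integral_diff)
  also have "\<bar>\<dots>\<bar> \<le> (\<integral>s. \<bar>(G z s - G (indicator U) s) * d s\<bar> \<partial>M)"
    by (rule integral_abs_bound)
  also have "\<dots> = (\<integral>s. \<bar>G z s - G (indicator U) s\<bar> * indicator D s \<partial>M)"
    by (simp add: abs_mult abs_d)
  also have "\<dots> \<le> norm_L2 M (\<lambda>s. G z s - G (indicator U) s) * sqrt (measure M D)"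
    by (intro integral_abs_mult_indicator_le G_diff_L2 z indicator_L1 U D)
  also have "norm_L2 M (\<lambda>s. G z s - G (indicator U) s) \<le> L * norm_L1 M (\<lambda>s. z s - indicator U s)"
    by (intro G_lipschitz z indicator_L1 U)
  also have "norm_L1 M (\<lambda>s. z s - indicator U s) = \<xi> * measure M D"
    using \<xi> D by (simp add: norm_L1_def z_def abs_mult abs_d)
  also have "L * (\<xi> * measure M D) \<le> L * (1 * measure M D)"
    using \<xi> L_nonneg by (intro mult_left_mono mult_right_mono) auto
  finally show ?thesis by (simp add: mult_right_mono algebra_simps)
qed

text \<open>The integrand is the positive part of the gradient on \<open>U\<close> and its negative
  part off \<open>U\<close>. This is the integrand of the criticality measure at
  \<open>indicator U\<close> for the maximizer \<open>f\<close>, the indicator of the set where the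
  gradient is negative.\<close>

abbreviation set_criticality :: "'a set \<Rightarrow> real" where
  "set_criticality U \<equiv> norm_L1 M (\<lambda>s. min (descent_density M G U s) 0)"

section \<open>Predicted decrease and continuity of the criticality\<close>

lemma descent_density_integrable:
  assumes U: "U \<in> sets M"
  shows "integrable M (descent_density M G U)"
proof (rule Bochner_Integration.integrable_bound[OF G_integrable[OF indicator_L1[OF U]]])
  show "descent_density M G U \<in> borel_measurable M"
    unfolding descent_density_def using U G_measurable[OF indicator_L1[OF U]] by measurable
qed (auto simp: descent_density_def indicator_def intro!: AE_I2)

lemma predicted_change_eq:
  "predicted_change M G U D = (\<integral>s. descent_density M G U s * indicator D s \<partial>M)"
  unfolding predicted_change_def inner_L2_def descent_density_def
  by (intro Bochner_Integration.integral_cong) (auto simp: indicator_def)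

text \<open>The bathtub set promises a decrease of \<open>\<Delta> / measure M (space M)\<close>
  times the criticality. The tolerance of the step search is small enough to forfeit at most half of
  it, whence the factor 2.\<close>

lemma predicted_change_le:
  assumes U: "U \<in> sets M" and \<Delta>: "0 < \<Delta>" "\<Delta> < measure M (space M)"
    and intermediate: "\<And>A B. A \<in> sets M \<Longrightarrow> B \<in> sets M \<Longrightarrow> A \<subseteq> B \<Longrightarrow> measure M A \<le> \<Delta>
      \<Longrightarrow> \<Delta> \<le> measure M B \<Longrightarrow> \<exists>E\<in>sets M. A \<subseteq> E \<and> E \<subseteq> B \<and> measure M E = \<Delta>"
    and step: "find_step M (descent_density M G U) \<Delta>
      (step_tolerance M \<omega> (descent_density M G U) \<Delta>) D"
  shows "predicted_change M G U D \<le> - (1 / (2 * measure M (space M)) * \<Delta> * set_criticality U)"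
proof -
  define g where "g = descent_density M G U"
  have g: "integrable M g" unfolding g_def by (rule descent_density_integrable[OF U])
  define f where "f s = \<bar>min (g s) 0\<bar>" for s
  have f: "integrable M f" unfolding f_def using g by simp
  obtain D' where D': "D' \<in> sets M" "\<And>s. s \<in> D' \<Longrightarrow> 0 < f s" "measure M D' \<le> \<Delta>"
    "\<Delta> * (\<integral>s. f s \<partial>M) \<le> measure M (space M) * (\<integral>s. f s * indicator D' s \<partial>M)"
    by (rule ex_set_integral_ge_average[OF f _ \<Delta> intermediate]) (auto simp: f_def)
  have crit: "(\<integral>s. f s \<partial>M) = set_criticality U" by (simp add: f_def g_def norm_L1_def)
  have cand: "D' \<in> step_candidates M g \<Delta>"
    using D'(1,2,3) by (fastforce simp: step_candidates_def f_def min_def split: if_splits)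
  \<comment> \<open>A real infimum is a lower bound only for a family that is bounded below; the L1
    norm of \<open>g\<close> bounds this one.\<close>
  have "bdd_below ((\<lambda>D'. \<integral>s. g s * indicator D' s \<partial>M) ` step_candidates M g \<Delta>)"
  proof (intro bdd_belowI2[where m = "- (\<integral>s. \<bar>g s\<bar> \<partial>M)"])
    fix B assume "B \<in> step_candidates M g \<Delta>"
    then have "integrable M (\<lambda>s. g s * indicator B s)"
      using integrable_real_mult_indicator[OF _ g] by (simp add: step_candidates_def)
    then have "(\<integral>s. - \<bar>g s\<bar> \<partial>M) \<le> (\<integral>s. g s * indicator B s \<partial>M)"
      using g by (intro integral_mono) (auto simp: indicator_def)
    then show "- (\<integral>s. \<bar>g s\<bar> \<partial>M) \<le> (\<integral>s. g s * indicator B s \<partial>M)" by simp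
  qed
  then have "(INF D'\<in>step_candidates M g \<Delta>. \<integral>s. g s * indicator D' s \<partial>M) \<le> (\<integral>s. g s * indicator D' s \<partial>M)"
    using cand by (rule cINF_lower)
  also have "\<dots> = (\<integral>s. - (f s * indicator D' s) \<partial>M)"
    using D'(2)
    by (intro Bochner_Integration.integral_cong) (fastforce simp: f_def indicator_def min_def split: if_splits)+
  also have "\<dots> \<le> - (\<Delta> / measure M (space M) * set_criticality U)"
    using D'(4) \<Delta> unfolding crit by (simp add: field_simps)
  finally have inf: "(INF D'\<in>step_candidates M g \<Delta>. \<integral>s. g s * indicator D' s \<partial>M)
    \<le> - (\<Delta> / measure M (space M) * set_criticality U)" .
  have "step_tolerance M \<omega> g \<Delta> \<le> 1 / 2 * set_criticality U / measure M (space M)"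
    unfolding step_tolerance_def g_def by (intro Min_le) auto
  then have "step_tolerance M \<omega> g \<Delta> * \<Delta> \<le> 1 / 2 * set_criticality U / measure M (space M) * \<Delta>"
    using \<Delta> by (intro mult_right_mono) auto
  moreover have "predicted_change M G U D \<le> (INF D'\<in>step_candidates M g \<Delta>. \<integral>s. g s * indicator D' s \<partial>M)
      + step_tolerance M \<omega> g \<Delta> * \<Delta>"
    using step unfolding find_step_def predicted_change_eq g_def by simp
  ultimately show ?thesis using inf by (simp add: field_simps)
qed

text \<open>Passing from \<open>U\<close> to \<open>V\<close> changes the gradient everywhere, which
  is measured by \<open>d\<close>, and flips the sign in the descent density on the symmetric
  difference, which costs twice the gradient there. Both effects are of the order of the square root
  of the measure of that set.\<close>

lemma abs_set_criticality_diff_le: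
  assumes U: "U \<in> sets M" and V: "V \<in> sets M"
  shows "\<bar>set_criticality U - set_criticality V\<bar>
    \<le> (3 * (L * measure M (space M)) + 2 * norm_L2 M (G (\<lambda>_. 0))) * sqrt (measure M (sym_diff U V))"
proof -
  let ?gU = "descent_density M G U" and ?gV = "descent_density M G V"
  let ?lam = "measure M (space M)" and ?S = "sym_diff U V"
  let ?m = "measure M ?S"
  have S[measurable]: "?S \<in> sets M" using U V by auto
  note L1 = indicator_L1[OF U] indicator_L1[OF V]
  have zero: "(\<lambda>_. 0) \<in> space_L1 M" by (simp add: space_L1_def)
  note gU = descent_density_integrable[OF U] and gV = descent_density_integrable[OF V]
  define d where "d s = G (indicator U) s - G (indicator V) s" for s
  \<comment> \<open>Comparison with the gradient at 0 bounds the L2 norm of the gradient uniformly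
    over all sets \<open>V\<close>.\<close>
  define e where "e s = G (indicator V) s - G (\<lambda>_. 0) s" for s
  have d: "d \<in> space_L2 M" unfolding d_def[abs_def] by (intro G_diff_L2 L1)
  have e: "e \<in> space_L2 M" unfolding e_def[abs_def] by (intro G_diff_L2 L1 zero)
  have int: "integrable M (\<lambda>s. \<bar>h s\<bar> * indicator A s)" if "h \<in> space_L2 M" "A \<in> sets M" for h A
  proof -
    have "integrable M h"
      using that(1) by (intro square_integrable_imp_integrable[of h]) (auto simp: space_L2_def)
    from integrable_real_mult_indicator[OF that(2) integrable_abs[OF this]] show ?thesis .
  qed
  have "set_criticality U - set_criticality V
      = (\<integral>s. \<bar>min (?gU s) 0\<bar> - \<bar>min (?gV s) 0\<bar> \<partial>M)"
    unfolding norm_L1_def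
    by (rule Bochner_Integration.integral_diff[symmetric]) (use gU gV in simp_all)
  then have "\<bar>set_criticality U - set_criticality V\<bar>
      = \<bar>\<integral>s. \<bar>min (?gU s) 0\<bar> - \<bar>min (?gV s) 0\<bar> \<partial>M\<bar>" by simp
  also have "\<dots> \<le> (\<integral>s. \<bar>\<bar>min (?gU s) 0\<bar> - \<bar>min (?gV s) 0\<bar>\<bar> \<partial>M)" by (rule integral_abs_bound)
  also have "\<dots> \<le> (\<integral>s. \<bar>d s\<bar> * indicator (space M) s + (2 * (\<bar>e s\<bar> * indicator ?S s)
      + 2 * (\<bar>G (\<lambda>_. 0) s\<bar> * indicator ?S s)) \<partial>M)"
  proof (rule integral_mono)
    fix s assume s: "s \<in> space M"
    have "\<bar>\<bar>min (?gU s) 0\<bar> - \<bar>min (?gV s) 0\<bar>\<bar> \<le> \<bar>?gU s - ?gV s\<bar>" by linarith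
    also have "\<dots> \<le> \<bar>d s\<bar> + 2 * \<bar>G (indicator V) s\<bar> * indicator ?S s"
      using s by (auto simp: descent_density_def d_def indicator_def)
    also have "\<dots> \<le> \<bar>d s\<bar> * indicator (space M) s
      + (2 * (\<bar>e s\<bar> * indicator ?S s) + 2 * (\<bar>G (\<lambda>_. 0) s\<bar> * indicator ?S s))"
    proof -
      have "\<bar>G (indicator V) s\<bar> \<le> \<bar>e s\<bar> + \<bar>G (\<lambda>_. 0) s\<bar>" unfolding e_def by linarith
      with s show ?thesis by (cases "s \<in> ?S") simp_all
    qed
    finally show "\<bar>\<bar>min (?gU s) 0\<bar> - \<bar>min (?gV s) 0\<bar>\<bar> \<le> \<bar>d s\<bar> * indicator (space M) s
      + (2 * (\<bar>e s\<bar> * indicator ?S s) + 2 * (\<bar>G (\<lambda>_. 0) s\<bar> * indicator ?S s))" .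
  next
    show "integrable M (\<lambda>s. \<bar>d s\<bar> * indicator (space M) s + (2 * (\<bar>e s\<bar> * indicator ?S s)
      + 2 * (\<bar>G (\<lambda>_. 0) s\<bar> * indicator ?S s)))"
      by (intro Bochner_Integration.integrable_add integrable_mult_right int d e G_L2 zero S sets.top)
  qed (use gU gV in auto)
  also have "\<dots> = (\<integral>s. \<bar>d s\<bar> * indicator (space M) s \<partial>M) + (2 * (\<integral>s. \<bar>e s\<bar> * indicator ?S s \<partial>M)
      + 2 * (\<integral>s. \<bar>G (\<lambda>_. 0) s\<bar> * indicator ?S s \<partial>M))"
    using int[OF d sets.top] int[OF e S] int[OF G_L2[OF zero] S]
    by (simp only: Bochner_Integration.integral_add integral_mult_right_zero
        Bochner_Integration.integrable_add integrable_mult_right)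
  also have "\<dots> \<le> norm_L2 M d * sqrt ?lam + (2 * (norm_L2 M e * sqrt ?m)
      + 2 * (norm_L2 M (G (\<lambda>_. 0)) * sqrt ?m))"
    by (intro add_mono mult_left_mono integral_abs_mult_indicator_le d e G_L2 zero S sets.top) auto
  also have "\<dots> \<le> L * ?lam * sqrt ?m + (2 * (L * ?lam * sqrt ?m) + 2 * (norm_L2 M (G (\<lambda>_. 0)) * sqrt ?m))"
  proof -
    have "norm_L2 M d \<le> L * norm_L1 M (\<lambda>s. indicator U s - indicator V s)"
      unfolding d_def[abs_def] by (intro G_lipschitz L1)
    also have "norm_L1 M (\<lambda>s. indicator U s - indicator V s) = (\<integral>s. indicator ?S s \<partial>M)"
      unfolding norm_L1_def by (intro Bochner_Integration.integral_cong) (auto simp: indicator_def)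
    also have "\<dots> = ?m" by simp
    \<comment> \<open>The Lipschitz bound is linear in \<open>?m\<close>; finiteness of the measure
      weakens it to the common rate \<open>sqrt ?m\<close>.\<close>
    also have "L * ?m \<le> L * (sqrt ?lam * sqrt ?m)"
    proof (intro mult_left_mono L_nonneg)
      have "?m = sqrt ?m * sqrt ?m" by simp
      also have "\<dots> \<le> sqrt ?lam * sqrt ?m"
        using S by (intro mult_right_mono) (auto intro: bounded_measure)
      finally show "?m \<le> sqrt ?lam * sqrt ?m" .
    qed
    finally have "norm_L2 M d * sqrt ?lam \<le> L * (sqrt ?lam * sqrt ?m) * sqrt ?lam"
      by (intro mult_right_mono) auto
    also have "\<dots> = L * ?lam * sqrt ?m" by simp
    finally have dd: "norm_L2 M d * sqrt ?lam \<le> L * ?lam * sqrt ?m" .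
    have "norm_L2 M e \<le> L * norm_L1 M (\<lambda>s. indicator V s - 0)"
      unfolding e_def[abs_def] by (intro G_lipschitz L1 zero)
    also have "\<dots> = L * measure M V" using V by (simp add: norm_L1_def)
    also have "\<dots> \<le> L * ?lam" by (intro mult_left_mono bounded_measure L_nonneg)
    finally have "norm_L2 M e * sqrt ?m \<le> L * ?lam * sqrt ?m" by (intro mult_right_mono) auto
    with dd show ?thesis by linarith
  qed
  finally show ?thesis by (simp add: algebra_simps)
qed

text \<open>The bound is pointwise: \<open>indicator U s - f s\<close> lies in \<open>[0, 1]\<close>
  on \<open>U\<close> and in \<open>[-1, 0]\<close> off \<open>U\<close>, so the product never
  exceeds the negative part of the descent density.\<close>

lemma integral_G_diff_feasible_le:
  assumes U: "U \<in> sets M" and f: "f \<in> feasible_R M"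
  shows "(\<integral>s. G (indicator U) s * (indicator U s - f s) \<partial>M) \<le> set_criticality U"
  unfolding norm_L1_def
proof (rule integral_mono_AE)
  have [measurable]: "f \<in> borel_measurable M" and f01: "AE s in M. 0 \<le> f s \<and> f s \<le> 1"
    using f by (auto simp: feasible_R_def space_L2_def)
  show "integrable M (\<lambda>s. G (indicator U) s * (indicator U s - f s))"
  proof (rule Bochner_Integration.integrable_bound[OF G_integrable[OF indicator_L1[OF U]]])
    show "AE s in M. norm (G (indicator U) s * (indicator U s - f s)) \<le> norm (G (indicator U) s)"
      using f01
    proof eventually_elim
      case (elim s)
      then have "\<bar>indicator U s - f s\<bar> \<le> 1" by (auto simp: indicator_def)
      then show ?case unfolding real_norm_def abs_mult by (rule mult_left_le) simp
    qed
    show "(\<lambda>s. G (indicator U) s * (indicator U s - f s)) \<in> borel_measurable M"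
      using G_measurable[OF indicator_L1[OF U]] U
      by (intro borel_measurable_times borel_measurable_diff borel_measurable_indicator) auto
  qed
  show "integrable M (\<lambda>s. \<bar>min (descent_density M G U s) 0\<bar>)"
    using descent_density_integrable[OF U] by simp
  show "AE s in M. G (indicator U) s * (indicator U s - f s) \<le> \<bar>min (descent_density M G U s) 0\<bar>"
    using f01 AE_space
  proof eventually_elim
    case (elim s)
    \<comment> \<open>Here \<open>- c\<close> stands for the value of the descent density, with
      \<open>a = 1 - f s\<close> on \<open>U\<close> and \<open>a = f s\<close> off
      \<open>U\<close>.\<close>
    have *: "c * a \<le> \<bar>min (- c) 0\<bar>" if "0 \<le> a" "a \<le> 1" for a c :: real
    proof (cases "0 \<le> c")
      case True
      then show ?thesis using mult_left_le[OF that(2) True] by simp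
    next
      case False
      then have "c * a \<le> 0" using that by (intro mult_nonpos_nonneg) auto
      then show ?thesis by linarith
    qed
    show ?case
    proof (cases "s \<in> U")
      case True
      then show ?thesis
        using elim *[of "1 - f s" "G (indicator U) s"] by (simp add: descent_density_def)
    next
      case False
      then show ?thesis
        using elim *[of "f s" "- G (indicator U) s"] by (simp add: descent_density_def)
    qed
  qed
qed

section \<open>Convergence of the criticality along a run, and stationarity of weak limits\<close>

lemma BTR_set_criticality_tendsto_0:
  assumes L: "0 < L"
    and bdd: "bdd_below (J ` space_L2 M)"
    and intermediate: "\<And>A B v. A \<in> sets M \<Longrightarrow> B \<in> sets M \<Longrightarrow> A \<subseteq> B \<Longrightarrow> measure M A \<le> v
      \<Longrightarrow> v \<le> measure M B \<Longrightarrow> \<exists>E\<in>sets M. A \<subseteq> E \<and> E \<subseteq> B \<and> measure M E = v"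
    and run: "BTR_run M J G \<Delta>max \<sigma>1 \<sigma>2 \<omega> U \<Delta> D"
  shows "U n \<in> sets M" and "(\<lambda>n. set_criticality (U n)) \<longlonglongrightarrow> 0"
proof -
  define a where "a n = actual_change J (U n) (D n)" for n
  define p where "p n = predicted_change M G (U n) (D n)" for n
  have params: "0 < \<Delta>max" "\<Delta>max < measure M (space M)" "0 < \<sigma>1" "\<sigma>1 < 1" "0 < \<Delta> 0" "\<Delta> 0 < \<Delta>max"
    and U0: "U 0 \<in> sets M"
    using run by (auto simp: BTR_run_def)
  have iteration: "find_step M (descent_density M G (U n)) (\<Delta> n)
      (step_tolerance M \<omega> (descent_density M G (U n)) (\<Delta> n)) (D n) \<and>
      (if a n \<le> \<sigma>1 * p n
       then U (Suc n) = sym_diff (U n) (D n) \<and>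
         \<Delta> (Suc n) = (if a n \<le> \<sigma>2 * p n then min (2 * \<Delta> n) \<Delta>max else \<Delta> n)
       else U (Suc n) = U n \<and> \<Delta> (Suc n) = \<Delta> n / 2)" for n
    using run unfolding BTR_run_def Let_def a_def p_def by blast
  have D: "D n \<in> sets M" "measure M (D n) \<le> \<Delta> n" for n
    using iteration[of n] by (auto simp: find_step_def step_candidates_def)
  have U: "U n \<in> sets M" for n
  proof (induction n)
    case (Suc n)
    then show ?case using iteration[of n] D(1)[of n] by (auto split: if_splits)
  qed (rule U0)
  then show "U n \<in> sets M" for n .
  \<comment> \<open>The cap \<open>\<Delta>max\<close> lies below the total measure, which keeps
    every radius in the range of \<open>predicted_change_le\<close>.\<close>
  have \<Delta>: "0 < \<Delta> n \<and> \<Delta> n \<le> \<Delta>max" for n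
  proof (induction n)
    case (Suc n)
    then show ?case using iteration[of n] params(1) by (auto split: if_splits)
  qed (use params in auto)
  define s where "s n = (if a n \<le> \<sigma>1 * p n then \<Delta> n else 0)" for n
  \<comment> \<open>The summand 1 makes the constant positive, as the abstract convergence lemma
    divides by it.\<close>
  define K where "K = 3 * (L * measure M (space M)) + 2 * norm_L2 M (G (\<lambda>_. 0)) + 1"
  have "0 \<le> norm_L2 M (G (\<lambda>_. 0))" by (simp add: norm_L2_def)
  then have K: "0 < K" unfolding K_def using L by (simp add: add_nonneg_pos)
  \<comment> \<open>Triangle inequality for symmetric differences: an accepted step adds at most
    \<open>measure M (D m)\<close>, a rejected one nothing.\<close>
  have displacement: "measure M (sym_diff (U n) (U m)) \<le> (\<Sum>i=n..<m. s i)" if "n \<le> m" for n m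
    using that
  proof (induction m rule: dec_induct)
    case (step m)
    have S: "sym_diff (U n) (U m) \<in> sets M" using U by auto
    show ?case
    proof (cases "a m \<le> \<sigma>1 * p m")
      case True
      then have "sym_diff (U n) (U (Suc m)) \<subseteq> sym_diff (U n) (U m) \<union> D m"
        using iteration[of m] by auto
      then have "measure M (sym_diff (U n) (U (Suc m))) \<le> measure M (sym_diff (U n) (U m) \<union> D m)"
        using S D(1)[of m] by (intro finite_measure_mono) auto
      also have "\<dots> \<le> measure M (sym_diff (U n) (U m)) + measure M (D m)"
        using S D(1)[of m] by (intro measure_Un_le)
      also have "\<dots> \<le> (\<Sum>i=n..<m. s i) + s m"
        using step.IH D(2)[of m] True by (simp add: s_def)
      finally show ?thesis using step by simp
    next
      case False
      then show ?thesis using step iteration[of m] by (simp add: s_def)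
    qed
  qed simp
  obtain c where c: "\<And>x. x \<in> space_L2 M \<Longrightarrow> c \<le> J x"
    using bdd by (auto simp: bdd_below_def)
  show "(\<lambda>n. set_criticality (U n)) \<longlonglongrightarrow> 0"
  proof (rule trust_region_criticality_tendsto_0
      [where \<kappa> = "1 / (2 * measure M (space M))" and L = L and K = K and \<sigma> = \<sigma>1 and \<Delta> = \<Delta>
        and p = p and a = a and s = s and J = "\<lambda>n. J (indicator (U n))" and c = c])
    show "0 < 1 / (2 * measure M (space M))" using params by simp
    show "0 \<le> set_criticality (U n)" for n
      unfolding norm_L1_def by (rule Bochner_Integration.integral_nonneg) simp
    show "p n \<le> - (1 / (2 * measure M (space M)) * \<Delta> n * set_criticality (U n))" for n
      unfolding p_def
      by (rule predicted_change_le[OF U _ _ intermediate])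
        (use iteration[of n] \<Delta>[of n] params in auto)
    show "a n - p n \<le> L * (\<Delta> n * sqrt (\<Delta> n))" for n
    proof -
      have "a n - p n \<le> L * (measure M (D n) * sqrt (measure M (D n)))"
        using abs_actual_minus_predicted_le[OF U[of n] D(1)[of n]] by (simp add: a_def p_def)
      also have "\<dots> \<le> L * (\<Delta> n * sqrt (\<Delta> n))"
        using D(2)[of n] \<Delta>[of n] L by (intro mult_left_mono mult_mono) auto
      finally show ?thesis .
    qed
    show "J (indicator (U (Suc n))) = J (indicator (U n)) + a n \<and> \<Delta> n \<le> \<Delta> (Suc n) \<and> s n = \<Delta> n"
      if "a n \<le> \<sigma>1 * p n" for n
      using that iteration[of n] \<Delta>[of n] by (simp add: s_def a_def actual_change_def)
    show "J (indicator (U (Suc n))) = J (indicator (U n)) \<and> \<Delta> (Suc n) = \<Delta> n / 2 \<and> s n = 0"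
      if "\<not> a n \<le> \<sigma>1 * p n" for n
      using that iteration[of n] by (simp add: s_def)
    show "c \<le> J (indicator (U n))" for n by (intro c indicator_L2 U)
    show "\<bar>set_criticality (U n) - set_criticality (U m)\<bar> \<le> K * sqrt (\<Sum>i=n..<m. s i)"
      if "n \<le> m" for n m
    proof -
      have "\<bar>set_criticality (U n) - set_criticality (U m)\<bar> \<le> (K - 1) * sqrt (measure M (sym_diff (U n) (U m)))"
        using abs_set_criticality_diff_le[OF U U] by (simp add: K_def)
      also have "\<dots> \<le> K * sqrt (\<Sum>i=n..<m. s i)"
        using displacement[OF that] K by (intro mult_mono) auto
      finally show ?thesis .
    qed
  qed (use params L K in auto)
qed

text \<open>In the product of gradient and iterate one factor converges in norm and the other
  weakly. Replacing the gradient at \<open>V k\<close> by the one at \<open>x\<close> costs at most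
  the norm of their difference times a constant, and against the fixed \<open>G x\<close> weak
  convergence suffices.\<close>

lemma stationary_weak_limit:
  assumes V: "\<And>k. V k \<in> sets M"
    and x: "x \<in> feasible_R M"
    and weak: "\<And>\<phi>. integrable M \<phi> \<Longrightarrow>
      (\<lambda>k. \<integral>s. indicator (V k) s * \<phi> s \<partial>M) \<longlonglongrightarrow> (\<integral>s. x s * \<phi> s \<partial>M)"
    and grad: "(\<lambda>k. norm_L2 M (\<lambda>s. G (indicator (V k)) s - G x s)) \<longlonglongrightarrow> 0"
    and crit: "(\<lambda>k. set_criticality (V k)) \<longlonglongrightarrow> 0"
  shows "stationary_R M G x"
proof -
  have xL2: "x \<in> space_L2 M" using x by (simp add: feasible_R_def)
  have xL1: "x \<in> space_L1 M"
    using xL2 square_integrable_imp_integrable[of x] by (simp only: space_L2_def space_L1_def mem_Collect_eq)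
  have le: "(\<integral>s. G x s * (x s - f s) \<partial>M) \<le> 0" if f: "f \<in> feasible_R M" for f
  proof -
    have fL2: "f \<in> space_L2 M" and f01: "AE s in M. 0 \<le> f s \<and> f s \<le> 1"
      using f by (auto simp: feasible_R_def)
    have Gf: "integrable M (\<lambda>s. G x s * f s)" by (rule Cauchy_Schwarz_L2(1)[OF G_L2[OF xL1] fL2])
    have Gx: "integrable M (\<lambda>s. G x s * x s)" by (rule Cauchy_Schwarz_L2(1)[OF G_L2[OF xL1] xL2])
    have GV: "integrable M (\<lambda>s. G y s * indicator (V k) s)" if "y \<in> space_L1 M" for y k
      by (rule Cauchy_Schwarz_L2(1)[OF G_L2[OF that] indicator_L2[OF V]])
    have "(\<lambda>k. (\<integral>s. indicator (V k) s * G x s \<partial>M) - (\<integral>s. G x s * f s \<partial>M))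
        \<longlonglongrightarrow> (\<integral>s. x s * G x s \<partial>M) - (\<integral>s. G x s * f s \<partial>M)"
      by (intro tendsto_intros weak G_integrable xL1)
    also have "(\<integral>s. x s * G x s \<partial>M) - (\<integral>s. G x s * f s \<partial>M) = (\<integral>s. G x s * (x s - f s) \<partial>M)"
      using Bochner_Integration.integral_diff[OF Gx Gf] by (simp add: algebra_simps)
    finally have lim: "(\<lambda>k. (\<integral>s. indicator (V k) s * G x s \<partial>M) - (\<integral>s. G x s * f s \<partial>M))
        \<longlonglongrightarrow> (\<integral>s. G x s * (x s - f s) \<partial>M)" .
    have "(\<lambda>k. set_criticality (V k) + norm_L2 M (\<lambda>s. G (indicator (V k)) s - G x s) * sqrt (measure M (space M)))
        \<longlonglongrightarrow> 0 + 0 * sqrt (measure M (space M))"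
      by (intro tendsto_intros crit grad)
    moreover have "(\<integral>s. indicator (V k) s * G x s \<partial>M) - (\<integral>s. G x s * f s \<partial>M)
        \<le> set_criticality (V k) + norm_L2 M (\<lambda>s. G (indicator (V k)) s - G x s) * sqrt (measure M (space M))" for k
    proof -
      let ?V = "indicator (V k) :: 'a \<Rightarrow> real"
      have VL1: "?V \<in> space_L1 M" by (rule indicator_L1[OF V])
      have GVf: "integrable M (\<lambda>s. G ?V s * (?V s - f s))"
        using GV[OF VL1] Cauchy_Schwarz_L2(1)[OF G_L2[OF VL1] fL2]
        unfolding right_diff_distrib by (rule Bochner_Integration.integrable_diff)
      have dL2: "(\<lambda>s. G ?V s - G x s) \<in> space_L2 M" by (rule G_diff_L2[OF VL1 xL1])
      have dint: "integrable M (\<lambda>s. \<bar>G ?V s - G x s\<bar> * indicator (space M) s)"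
        using G_integrable[OF VL1] G_integrable[OF xL1]
        by (intro integrable_real_mult_indicator integrable_abs Bochner_Integration.integrable_diff) auto
      have "(\<integral>s. ?V s * G x s \<partial>M) - (\<integral>s. G x s * f s \<partial>M) = (\<integral>s. G x s * ?V s - G x s * f s \<partial>M)"
        using Bochner_Integration.integral_diff[OF GV[OF xL1] Gf] by (simp add: mult.commute)
      also have "\<dots> \<le> (\<integral>s. G ?V s * (?V s - f s) + \<bar>G ?V s - G x s\<bar> * indicator (space M) s \<partial>M)"
      proof (rule integral_mono_AE)
        show "AE s in M. G x s * ?V s - G x s * f s
            \<le> G ?V s * (?V s - f s) + \<bar>G ?V s - G x s\<bar> * indicator (space M) s"
          using f01 AE_space
        proof eventually_elim
          case (elim s)
          then have "\<bar>?V s - f s\<bar> \<le> 1" by (auto simp: indicator_def)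
          then have "\<bar>(G x s - G ?V s) * (?V s - f s)\<bar> \<le> \<bar>G x s - G ?V s\<bar>"
            unfolding abs_mult by (rule mult_left_le) simp
          then have "(G x s - G ?V s) * (?V s - f s) \<le> \<bar>G ?V s - G x s\<bar>" by linarith
          then show ?case using elim by (simp add: algebra_simps)
        qed
      qed (intro Bochner_Integration.integrable_diff Bochner_Integration.integrable_add
          GV xL1 Gf GVf dint)+
      also have "\<dots> = (\<integral>s. G ?V s * (?V s - f s) \<partial>M) + (\<integral>s. \<bar>G ?V s - G x s\<bar> * indicator (space M) s \<partial>M)"
        by (rule Bochner_Integration.integral_add[OF GVf dint])
      also have "\<dots> \<le> set_criticality (V k) + norm_L2 M (\<lambda>s. G ?V s - G x s) * sqrt (measure M (space M))"
        by (intro add_mono integral_G_diff_feasible_le[OF V f] integral_abs_mult_indicator_le[OF dL2 sets.top])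
      finally show ?thesis .
    qed
    ultimately have "(\<integral>s. G x s * (x s - f s) \<partial>M) \<le> 0 + 0 * sqrt (measure M (space M))"
      by (intro LIMSEQ_le[OF lim]) auto
    then show ?thesis by simp
  qed
  have "criticality M G x = 0"
    unfolding criticality_def
  proof (rule cSup_eq_maximum)
    \<comment> \<open>The choice \<open>f = x\<close> attains 0, so the supremum is a
      maximum.\<close>
    show "0 \<in> (\<lambda>f. \<integral>s. G x s * (x s - f s) \<partial>M) ` feasible_R M"
      using x by (intro image_eqI[of _ _ x]) simp_all
  qed (use le in auto)
  with x show ?thesis by (simp add: stationary_R_def)
qed

end

section \<open>Accumulation points of the iterates\<close>

lemma (in finite_measure) AE_nonneg_if_integrals_nonneg:
  fixes f :: "'a \<Rightarrow> real"
  assumes f: "integrable M f" and nonneg: "\<And>A. A \<in> sets M \<Longrightarrow> 0 \<le> (\<integral>s. f s * indicator A s \<partial>M)"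
  shows "AE s in M. 0 \<le> f s"
proof -
  have [measurable]: "f \<in> borel_measurable M" using f by simp
  define A where "A = {s \<in> space M. f s < 0}"
  have A: "A \<in> sets M" unfolding A_def by measurable
  have int: "integrable M (\<lambda>s. - (f s * indicator A s))"
    using integrable_real_mult_indicator[OF A f] by simp
  have ge: "AE s in M. 0 \<le> - (f s * indicator A s)"
    by (rule AE_I2) (auto simp: A_def indicator_def)
  have "(\<integral>s. - (f s * indicator A s) \<partial>M) \<ge> 0" using ge by (rule integral_nonneg_AE)
  then have "(\<integral>s. - (f s * indicator A s) \<partial>M) = 0" using nonneg[OF A] by simp
  then have "AE s in M. - (f s * indicator A s) = 0"
    using integral_nonneg_eq_0_iff_AE[OF int ge] by simp
  then show ?thesis using AE_space by eventually_elim (auto simp: A_def indicator_def)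
qed

text \<open>Tested with the indicator of \<open>A\<close>, the sequence gives
  \<open>measure M (V k \<inter> A)\<close>, which lies between 0 and \<open>measure M A\<close>. In
  the limit \<open>x\<close> and \<open>1 - x\<close> have nonnegative integrals over every
  measurable set.\<close>

lemma (in finite_measure) weak_limit_of_indicators_feasible:
  assumes V: "\<And>k. V k \<in> sets M"
    and x: "x \<in> space_Linf M"
    and weak: "\<And>\<phi>. integrable M \<phi> \<Longrightarrow>
      (\<lambda>k. \<integral>s. indicator (V k) s * \<phi> s \<partial>M) \<longlonglongrightarrow> (\<integral>s. x s * \<phi> s \<partial>M)"
  shows "x \<in> feasible_R M"
proof -
  obtain b where xm[measurable]: "x \<in> borel_measurable M" and b: "AE s in M. \<bar>x s\<bar> \<le> b"
    using x by (auto simp: space_Linf_def)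
  have xint: "integrable M x" by (rule integrable_const_bound[where B = b]) (use b in auto)
  have ind: "integrable M (indicator A :: 'a \<Rightarrow> real)" if "A \<in> sets M" for A
    using that by (simp add: less_top[symmetric])
  have lim: "(\<lambda>k. measure M (V k \<inter> A)) \<longlonglongrightarrow> (\<integral>s. x s * indicator A s \<partial>M)" if A: "A \<in> sets M" for A
  proof -
    have "(\<integral>s. indicator (V k) s * indicator A s \<partial>M) = measure M (V k \<inter> A)" for k
      using A V[of k] by (simp add: indicator_inter_arith[symmetric])
    then show ?thesis using weak[OF ind[OF A]] by simp
  qed
  have "AE s in M. 0 \<le> x s"
  proof (rule AE_nonneg_if_integrals_nonneg[OF xint])
    fix A assume "A \<in> sets M"
    from lim[OF this] show "0 \<le> (\<integral>s. x s * indicator A s \<partial>M)"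
      by (rule LIMSEQ_le_const) simp
  qed
  moreover have "AE s in M. 0 \<le> 1 - x s"
  proof (rule AE_nonneg_if_integrals_nonneg)
    show "integrable M (\<lambda>s. 1 - x s)" using xint by simp
    fix A assume A: "A \<in> sets M"
    have "(\<integral>s. x s * indicator A s \<partial>M) \<le> measure M A"
      by (rule LIMSEQ_le_const2[OF lim[OF A]]) (use A V in \<open>auto intro!: finite_measure_mono\<close>)
    moreover have "(\<integral>s. (1 - x s) * indicator A s \<partial>M) = measure M A - (\<integral>s. x s * indicator A s \<partial>M)"
      using Bochner_Integration.integral_diff[OF ind[OF A] integrable_real_mult_indicator[OF A xint]] A
      by (simp add: left_diff_distrib)
    ultimately show "0 \<le> (\<integral>s. (1 - x s) * indicator A s \<partial>M)" by simp
  qed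
  ultimately have x01: "AE s in M. 0 \<le> x s \<and> x s \<le> 1" by eventually_elim simp
  have "integrable M (\<lambda>s. (x s)\<^sup>2)"
  proof (rule integrable_const_bound[where B = 1])
    show "AE s in M. norm ((x s)\<^sup>2) \<le> 1"
      using x01 by eventually_elim (simp add: power_le_one)
  qed measurable
  with x01 show ?thesis by (simp add: feasible_R_def space_L2_def)
qed

text \<open>Finite intersections of a countable base of open sets again form a countable base, now
  closed under intersection; their traces on \<open>\<Omega>\<close> generate the trace
  sigma-algebra.\<close>

lemma countable_Int_stable_generator_restrict_lborel:
  fixes \<Omega> :: "'a::euclidean_space set"
  assumes \<Omega>: "\<Omega> \<in> sets borel"
  obtains E where "countable E" "Int_stable E" "E \<subseteq> Pow \<Omega>"
    "sets (restrict_space lborel \<Omega>) = sigma_sets \<Omega> E"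
proof -
  obtain B :: "'a set set" where B: "countable B" "topological_basis B"
    using ex_countable_basis by blast
  define F where "F = Inter ` {X. finite X \<and> X \<subseteq> B}"
  have F: "countable F"
    unfolding F_def using countable_Collect_finite_subset[OF B(1)] by (simp add: conj_commute)
  have stable: "X \<inter> Y \<in> F" if "X \<in> F" "Y \<in> F" for X Y
  proof -
    obtain X' Y' where "finite X'" "X' \<subseteq> B" "X = \<Inter>X'" "finite Y'" "Y' \<subseteq> B" "Y = \<Inter>Y'"
      using \<open>X \<in> F\<close> \<open>Y \<in> F\<close> unfolding F_def by blast
    then show ?thesis unfolding F_def by (intro image_eqI[of _ _ "X' \<union> Y'"]) auto
  qed
  have "B \<subseteq> F"
  proof
    fix b assume "b \<in> B"
    then show "b \<in> F" unfolding F_def by (intro image_eqI[of _ _ "{b}"]) auto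
  qed
  moreover have "open X" if "X \<in> F" for X
    using that topological_basis_open[OF B(2)] unfolding F_def by (auto intro!: open_Inter)
  ultimately have "topological_basis F"
    using B(2) unfolding topological_basis_def by (meson order_trans)
  from arg_cong[OF borel_eq_countable_basis[OF F this], of sets]
  have borel: "sets (borel :: 'a measure) = sigma_sets UNIV F" by (simp add: sets_measure_of)
  show ?thesis
  proof (rule that[of "(\<inter>) \<Omega> ` F"])
    show "Int_stable ((\<inter>) \<Omega> ` F)"
    proof (rule Int_stableI)
      fix a b assume "a \<in> (\<inter>) \<Omega> ` F" "b \<in> (\<inter>) \<Omega> ` F"
      then obtain X Y where "X \<in> F" "Y \<in> F" "a = \<Omega> \<inter> X" "b = \<Omega> \<inter> Y" by blast
      with stable[of X Y] show "a \<inter> b \<in> (\<inter>) \<Omega> ` F"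
        by (intro image_eqI[of _ _ "X \<inter> Y"]) auto
    qed
    show "sets (restrict_space lborel \<Omega>) = sigma_sets \<Omega> ((\<inter>) \<Omega> ` F)"
      using sigma_sets_Int[of \<Omega> UNIV F] \<Omega> unfolding sets_restrict_space by (simp add: borel)
  qed (use F in auto)
qed

theorem corollary4p5:
  fixes \<Omega> :: "'a::euclidean_space set"
    and J :: "('a \<Rightarrow> real) \<Rightarrow> real"
    and G :: "('a \<Rightarrow> real) \<Rightarrow> 'a \<Rightarrow> real"
    and \<Delta>max \<sigma>1 \<sigma>2 \<omega> :: real
    and U D :: "nat \<Rightarrow> 'a set"
    and \<Delta> :: "nat \<Rightarrow> real"
    and x :: "'a \<Rightarrow> real"
  defines "M \<equiv> restrict_space lborel \<Omega>"
  assumes domain: "open \<Omega>" "connected \<Omega>" "\<Omega> \<noteq> {}" "bounded \<Omega>"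
    and J_well_defined: "AE_invariant M J"
    and J_bounded_below: "bdd_below (J ` space_L2 M)"
    and J_differentiable: "L1_differentiable M J"
    and J_gradient: "is_gradient M J G"
    and G_lipschitz: "lipschitz_L1_L2 M G"
    and G_weak_norm_continuous: "weak_norm_continuous_L2 M G"
    and run: "BTR_run M J G \<Delta>max \<sigma>1 \<sigma>2 \<omega> U \<Delta> D"
    and acc: "accumulation_point (weak_star_topology M) (\<lambda>n. indicator (U n)) x"
  shows "x \<in> feasible_R M \<and> stationary_R M G x"
proof -
  have \<Omega>: "\<Omega> \<in> sets borel" using domain by simp
  have space: "space M = \<Omega>" by (simp add: M_def space_restrict_space)
  have sets: "A \<in> sets M \<longleftrightarrow> A \<in> sets borel \<and> A \<subseteq> \<Omega>" for A
    using \<Omega> unfolding M_def by (auto simp: sets_restrict_space_iff)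
  have measure: "measure M A = measure lborel A" if "A \<in> sets M" for A
    using \<Omega> that sets unfolding M_def by (intro measure_restrict_space) auto
  have fin: "finite_measure M"
  proof
    show "emeasure M (space M) \<noteq> \<infinity>"
      unfolding space unfolding M_def
      using emeasure_bounded_finite[OF domain(4)] \<Omega> by (simp add: emeasure_restrict_space)
  qed
  obtain L where L: "\<And>x y. x \<in> space_L1 M \<Longrightarrow> y \<in> space_L1 M \<Longrightarrow>
      norm_L2 M (\<lambda>s. G x s - G y s) \<le> L * norm_L1 M (\<lambda>s. x s - y s)"
    and G_L2: "\<And>x. x \<in> space_L1 M \<Longrightarrow> G x \<in> space_L2 M"
    using G_lipschitz unfolding lipschitz_L1_L2_def by blast
  interpret finite_measure M by (rule fin)
  \<comment> \<open>The constant \<open>L\<close> supplied by the hypothesis may have any sign;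
    \<open>\<bar>L\<bar> + 1\<close> is an admissible positive one.\<close>
  interpret L1_smooth_functional M J G "\<bar>L\<bar> + 1"
  proof
    fix x y assume xy: "x \<in> space_L1 M" "y \<in> space_L1 M"
    have "L * norm_L1 M (\<lambda>s. x s - y s) \<le> (\<bar>L\<bar> + 1) * norm_L1 M (\<lambda>s. x s - y s)"
      by (intro mult_right_mono) (auto simp: norm_L1_def)
    with L[OF xy] show "norm_L2 M (\<lambda>s. G x s - G y s) \<le> (\<bar>L\<bar> + 1) * norm_L1 M (\<lambda>s. x s - y s)"
      by linarith
  qed (use J_gradient G_L2 in auto)
  have intermediate: "\<exists>E\<in>sets M. A \<subseteq> E \<and> E \<subseteq> B \<and> measure M E = v"
    if AB: "A \<in> sets M" "B \<in> sets M" "A \<subseteq> B" "measure M A \<le> v" "v \<le> measure M B" for A B v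
  proof -
    have "bounded B" using AB(2) sets domain(4) bounded_subset by blast
    then obtain E where "E \<in> sets borel" "A \<subseteq> E" "E \<subseteq> B" "measure lborel E = v"
      using lborel_intermediate_set[of A B v] AB measure sets by auto
    then show ?thesis using AB(2) measure[of E] sets by auto
  qed
  note run_facts = BTR_set_criticality_tendsto_0[OF _ J_bounded_below intermediate run]
  have U: "U n \<in> sets M" for n by (rule run_facts(1)) auto
  have crit: "(\<lambda>n. set_criticality (U n)) \<longlonglongrightarrow> 0" by (rule run_facts(2)) auto
  obtain E where E: "countable E" "Int_stable E" "E \<subseteq> Pow (space M)" "sets M = sigma_sets (space M) E"
    using countable_Int_stable_generator_restrict_lborel[OF \<Omega>] unfolding M_def[symmetric] space by metis
  obtain r where r: "strict_mono r" "\<And>\<phi>. integrable M \<phi> \<Longrightarrow>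
      (\<lambda>k. \<integral>s. indicator (U (r k)) s * \<phi> s \<partial>M) \<longlonglongrightarrow> (\<integral>s. x s * \<phi> s \<partial>M)"
    by (rule weak_star_accumulation_point_subseq[OF fin E _ _ acc, of 1])
       (use U in \<open>auto simp: indicator_def\<close>)
  have "x \<in> space_Linf M"
    using acc by (auto simp: accumulation_point_def weak_star_topology_def)
  then have feasible: "x \<in> feasible_R M"
    by (intro weak_limit_of_indicators_feasible[of "\<lambda>k. U (r k)"] U r(2))
  have "weakly_converges_L2 M (\<lambda>k. indicator (U (r k))) x"
    unfolding weakly_converges_L2_def inner_L2_def
  proof
    \<comment> \<open>On a finite measure space L2 is contained in L1, so weak-* convergence covers
      all L2 test functions.\<close>
    fix \<phi> assume "\<phi> \<in> space_L2 M"
    then have "integrable M \<phi>"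
      by (intro square_integrable_imp_integrable[of \<phi>]) (auto simp: space_L2_def)
    then show "(\<lambda>k. \<integral>s. indicator (U (r k)) s * \<phi> s \<partial>M) \<longlonglongrightarrow> (\<integral>s. x s * \<phi> s \<partial>M)" by (rule r(2))
  qed
  then have "(\<lambda>k. norm_L2 M (\<lambda>s. G (indicator (U (r k))) s - G x s)) \<longlonglongrightarrow> 0"
    using G_weak_norm_continuous[unfolded weak_norm_continuous_L2_def, rule_format,
        of "\<lambda>k. indicator (U (r k))" x] feasible indicator_L2[OF U]
    by (simp add: feasible_R_def)
  moreover have "(\<lambda>k. set_criticality (U (r k))) \<longlonglongrightarrow> 0"
    using LIMSEQ_subseq_LIMSEQ[OF crit r(1)] by (simp add: o_def)
  ultimately have "stationary_R M G x"
    by (intro stationary_weak_limit[of "\<lambda>k. U (r k)"] U feasible r(2))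
  with feasible show ?thesis ..
qed

end
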